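(* Let $0<p<\infty$ and $\mathbf w\in\mathcal W$. The Garling sequence space $g(\mathbf w,p)$ contains a family, of the cardinality of the continuum, of pairwise inequivalent subsymmetric basic sequences which is totally ordered in the domination ordering (i.e. of any two members of the family, one dominates the other). The space $g(\mathbf w,p)$ also contains a family, of the cardinality of the continuum, of subsymmetric basic sequences which are pairwise incomparable in the domination ordering (i.e. for any two distinct members of the family, neither dominates the other).
   Context: $\mathcal W$ is the set of sequences $\mathbf w=(w_j)_{j=1}^\infty\in c_0\setminus\ell_1$ with $1=w_1\ge w_2\ge\cdots>0$. $g(\mathbf w,p)$ is the quasi-Banach space of (real or complex) scalar sequences $x=(a_j)_{j=1}^\infty$ with $\|x\|_g=\sup_{\phi}\big(\sum_{j=1}^\infty|a_{\phi(j)}|^pw_j\big)^{1/p}<\infty$, the supremum being over all (strictly) increasing maps $\phi\colon\mathbb N\to\mathbb N$. A basic sequence in a quasi-Banach space is a sequence that is a Schauder basis of its closed linear span. A basic sequence $(x_j)$ dominates $(y_j)$ if there is a bounded linear operator from the closed span of $(x_j)$ to that of $(y_j)$ sending $x_j$ to $y_j$ for all $j$; the two are equivalent if each dominates the other. A basic sequence $(x_j)$ is subsymmetric if it is unconditional (every permutation of it is a basic sequence) and $(x_{\phi(j)})_j$ is equivalent to $(x_j)_j$ for every increasing $\phi\colon\mathbb N\to\mathbb N$. *)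

theory Defs
  imports "HOL-Analysis.Analysis" "HOL-Library.Function_Algebras" "HOL-Library.Equipollence"
begin

text \<open>
  Sequences are indexed from 0, so \<open>w 0\<close> and \<open>x 0\<close> are the first terms.
  The scalar field is a type \<open>'k :: {real_normed_field, banach}\<close>; up to isometric isomorphism
  the only such fields are the real and the complex numbers.
  Vectors are functions \<open>nat \<Rightarrow> 'k\<close> with the pointwise operations.
\<close>

definition seq_scale :: "'k::real_normed_field \<Rightarrow> (nat \<Rightarrow> 'k) \<Rightarrow> (nat \<Rightarrow> 'k)" where
  "seq_scale c x = (\<lambda>n. c * x n)"

interpretation seq: vector_space "seq_scale :: 'k::real_normed_field \<Rightarrow> _"
  by unfold_locales (auto simp: seq_scale_def algebra_simps fun_eq_iff)

text \<open>
  Below, \<open>X\<close> is the underlying set of a quasi-normed space of scalar sequences and \<open>N\<close> is its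
  quasi-norm (whose values outside \<open>X\<close> are irrelevant). Since the sets \<open>{v. N v < \<epsilon>}\<close> form a
  neighbourhood base of the origin, closures and limits can be expressed directly through \<open>N\<close>.
\<close>

definition closed_span ::
  "(nat \<Rightarrow> 'k::real_normed_field) set \<Rightarrow> ((nat \<Rightarrow> 'k) \<Rightarrow> real) \<Rightarrow> (nat \<Rightarrow> nat \<Rightarrow> 'k) \<Rightarrow> (nat \<Rightarrow> 'k) set"
where
  "closed_span X N x = {v \<in> X. \<forall>\<epsilon>>0. \<exists>u \<in> seq.span (range x). N (v - u) < \<epsilon>}"

definition basic_sequence ::
  "(nat \<Rightarrow> 'k::real_normed_field) set \<Rightarrow> ((nat \<Rightarrow> 'k) \<Rightarrow> real) \<Rightarrow> (nat \<Rightarrow> nat \<Rightarrow> 'k) \<Rightarrow> bool"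
where
  "basic_sequence X N x \<longleftrightarrow>
     range x \<subseteq> X \<and>
     (\<forall>v \<in> closed_span X N x.
        \<exists>!a :: nat \<Rightarrow> 'k. (\<lambda>n. N (v - (\<Sum>j<n. seq_scale (a j) (x j)))) \<longlonglongrightarrow> 0)"

definition dominates ::
  "(nat \<Rightarrow> 'k::real_normed_field) set \<Rightarrow> ((nat \<Rightarrow> 'k) \<Rightarrow> real) \<Rightarrow>
     (nat \<Rightarrow> nat \<Rightarrow> 'k) \<Rightarrow> (nat \<Rightarrow> nat \<Rightarrow> 'k) \<Rightarrow> bool"
where
  "dominates X N x y \<longleftrightarrow>
     (\<exists>T :: (nat \<Rightarrow> 'k) \<Rightarrow> (nat \<Rightarrow> 'k).
        T ` closed_span X N x \<subseteq> closed_span X N y \<and>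
        (\<forall>u \<in> closed_span X N x. \<forall>v \<in> closed_span X N x. T (u + v) = T u + T v) \<and>
        (\<forall>c. \<forall>v \<in> closed_span X N x. T (seq_scale c v) = seq_scale c (T v)) \<and>
        (\<exists>C. \<forall>v \<in> closed_span X N x. N (T v) \<le> C * N v) \<and>
        (\<forall>j. T (x j) = y j))"

definition equivalent_seqs ::
  "(nat \<Rightarrow> 'k::real_normed_field) set \<Rightarrow> ((nat \<Rightarrow> 'k) \<Rightarrow> real) \<Rightarrow>
     (nat \<Rightarrow> nat \<Rightarrow> 'k) \<Rightarrow> (nat \<Rightarrow> nat \<Rightarrow> 'k) \<Rightarrow> bool"
where
  "equivalent_seqs X N x y \<longleftrightarrow> dominates X N x y \<and> dominates X N y x"

definition unconditional ::
  "(nat \<Rightarrow> 'k::real_normed_field) set \<Rightarrow> ((nat \<Rightarrow> 'k) \<Rightarrow> real) \<Rightarrow> (nat \<Rightarrow> nat \<Rightarrow> 'k) \<Rightarrow> bool"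
where
  "unconditional X N x \<longleftrightarrow> (\<forall>\<pi> :: nat \<Rightarrow> nat. bij \<pi> \<longrightarrow> basic_sequence X N (x \<circ> \<pi>))"

text \<open>
  A sequence equivalent to a basic sequence is itself basic, so this need not be required
  of \<open>x \<circ> \<phi>\<close> separately.
\<close>

definition subsymmetric ::
  "(nat \<Rightarrow> 'k::real_normed_field) set \<Rightarrow> ((nat \<Rightarrow> 'k) \<Rightarrow> real) \<Rightarrow> (nat \<Rightarrow> nat \<Rightarrow> 'k) \<Rightarrow> bool"
where
  "subsymmetric X N x \<longleftrightarrow>
     basic_sequence X N x \<and> unconditional X N x \<and>
     (\<forall>\<phi> :: nat \<Rightarrow> nat. strict_mono \<phi> \<longrightarrow> equivalent_seqs X N (x \<circ> \<phi>) x)"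

definition garling_weights :: "(nat \<Rightarrow> real) set" where
  "garling_weights =
     {w. w \<longlonglongrightarrow> 0 \<and> \<not> summable (\<lambda>j. \<bar>w j\<bar>) \<and> w 0 = 1 \<and> decseq w \<and> (\<forall>j. 0 < w j)}"

definition garling_sum ::
  "(nat \<Rightarrow> real) \<Rightarrow> real \<Rightarrow> (nat \<Rightarrow> 'k::real_normed_field) \<Rightarrow> (nat \<Rightarrow> nat) \<Rightarrow> real"
where
  "garling_sum w p x \<phi> = (\<Sum>j. norm (x (\<phi> j)) powr p * w j) powr (1 / p)"

text \<open>
  The supremum in the definition of the norm is finite iff all the series converge and their
  \<open>p\<close>-th roots are bounded; only then does the real-valued supremum \<open>garling_norm\<close> have meaning.
\<close>

definition garling_space :: "(nat \<Rightarrow> real) \<Rightarrow> real \<Rightarrow> (nat \<Rightarrow> 'k::real_normed_field) set" where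
  "garling_space w p =
     {x. (\<forall>\<phi>. strict_mono \<phi> \<longrightarrow> summable (\<lambda>j. norm (x (\<phi> j)) powr p * w j)) \<and>
         bdd_above (garling_sum w p x ` {\<phi>. strict_mono \<phi>})}"

definition garling_norm :: "(nat \<Rightarrow> real) \<Rightarrow> real \<Rightarrow> (nat \<Rightarrow> 'k::real_normed_field) \<Rightarrow> real" where
  "garling_norm w p x = (SUP \<phi> \<in> {\<phi>. strict_mono \<phi>}. garling_sum w p x \<phi>)"

end

theory Submission
  imports Defs
begin

text \<open>
  Call \<open>\<Phi> u\<close> the supremum over all finite \<open>A\<close> of the sums of \<open>u i * w (rank of i in A)\<close>, so that the
  \<open>p\<close>-th power of the Garling norm of \<open>x\<close> is \<open>\<Phi> \<bar>x\<bar>\<^sup>p\<close>. This functional is monotone, sublinear and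
  spreading invariant. Fix a shape \<open>c\<close> with \<open>c 0 = 1\<close> and put longer and longer truncations of it into
  successive blocks of \<open>\<nat>\<close>: since the tails of \<open>c\<close> are small, the resulting disjointly supported
  sequence is subsymmetric.

  The shape is a concatenation of finite groups \<open>g 0, g 1, \<dots>\<close>. Because \<open>w\<close> tends to 0, a group can
  have an arbitrarily small \<open>\<Phi>\<close> and yet, for some \<open>N\<close>, the sum of \<open>N\<close> successive copies can exceed any
  prescribed multiple of \<open>W N = w 0 + \<dots> + w (N - 1)\<close>. Choosing the groups recursively, with the later
  ones negligible for \<open>N\<close> copies and the earlier ones contributing at most their total mass times
  \<open>W N\<close>, makes each group visible to the norm of the sum of \<open>N\<close> consecutive blocks. Keeping only
  the groups with index in \<open>A \<subseteq> \<nat>\<close>, the sequence of \<open>B\<close> dominates that of \<open>A\<close> if \<open>A \<subseteq> B\<close>, and the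
  sequence of \<open>A\<close> does not dominate that of \<open>B\<close> if \<open>B - A\<close> is infinite. Dedekind cuts then give the
  chain and the antichain.
\<close>

section \<open>Rank-weighted sums\<close>

definition ranked_sum :: "(nat \<Rightarrow> real) \<Rightarrow> (nat \<Rightarrow> real) \<Rightarrow> nat set \<Rightarrow> real" where
  "ranked_sum w u A = (\<Sum>i\<in>A. u i * w (card (A \<inter> {..<i})))"

text \<open>With values in \<open>ennreal\<close> the supremum always exists, so membership in the
  Garling space becomes finiteness of this number and estimates carry no boundedness
  conditions.\<close>

definition garling_mass :: "(nat \<Rightarrow> real) \<Rightarrow> (nat \<Rightarrow> real) \<Rightarrow> ennreal" where
  "garling_mass w u = (SUP A\<in>{A. finite A}. ennreal (ranked_sum w u A))"

lemma rank_less_card: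
  fixes A :: "nat set"
  assumes "finite A" "i \<in> A"
  shows "card (A \<inter> {..<i}) < card A"
  using assms by (intro psubset_card_mono) auto

lemma bij_betw_rank:
  fixes A :: "nat set"
  assumes "finite A"
  shows "bij_betw (\<lambda>i. card (A \<inter> {..<i})) A {..<card A}"
proof -
  have mono: "card (A \<inter> {..<i}) < card (A \<inter> {..<j})" if "i \<in> A" "i < j" for i j
    using that assms by (intro psubset_card_mono) auto
  have inj: "inj_on (\<lambda>i. card (A \<inter> {..<i})) A"
    by (metis (mono_tags, lifting) inj_onI mono nat_neq_iff)
  moreover have "(\<lambda>i. card (A \<inter> {..<i})) ` A \<subseteq> {..<card A}"
    using rank_less_card[OF assms] by auto
  ultimately show ?thesis
    by (simp add: bij_betw_def card_image card_subset_eq)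
qed

lemma sum_rank:
  fixes A :: "nat set" and f :: "nat \<Rightarrow> real"
  assumes "finite A"
  shows "(\<Sum>i\<in>A. f (card (A \<inter> {..<i}))) = (\<Sum>k<card A. f k)"
  using sum.reindex_bij_betw[OF bij_betw_rank[OF assms]] .

lemma ranked_sum_add: "ranked_sum w (\<lambda>i. u i + v i) A = ranked_sum w u A + ranked_sum w v A"
  by (simp add: ranked_sum_def algebra_simps sum.distrib)

lemma ranked_sum_scale: "ranked_sum w (\<lambda>i. c * u i) A = c * ranked_sum w u A"
  by (simp add: ranked_sum_def sum_distrib_left mult.assoc)

lemma ranked_sum_cong:
  "(\<And>i. i \<in> A \<Longrightarrow> u i = v i) \<Longrightarrow> ranked_sum w u A = ranked_sum w v A"
  by (simp add: ranked_sum_def)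

text \<open>A strictly increasing map preserves ranks; this is the source of spreading
  invariance.\<close>

lemma ranked_sum_image:
  assumes "strict_mono_on A \<psi>"
  shows "ranked_sum w u (\<psi> ` A) = ranked_sum w (\<lambda>i. u (\<psi> i)) A"
proof -
  have inj: "inj_on \<psi> A" using assms by (rule strict_mono_on_imp_inj_on)
  have "\<psi> ` A \<inter> {..<\<psi> i} = \<psi> ` (A \<inter> {..<i})" if "i \<in> A" for i
    using that strict_mono_on_less[OF assms] by auto
  moreover have "card (\<psi> ` (A \<inter> {..<i})) = card (A \<inter> {..<i})" for i
    by (rule card_image) (rule inj_on_subset[OF inj], auto)
  ultimately show ?thesis
    unfolding ranked_sum_def by (subst sum.reindex[OF inj]) (auto intro!: sum.cong)
qed

text \<open>All of \<open>B\<close> follows all of \<open>A\<close>, so ranks in \<open>B\<close>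
  are pushed up by \<open>card A\<close> and ranks in \<open>A\<close> stay the same.\<close>

lemma ranked_sum_Un:
  assumes "finite A" "finite B" and less: "\<And>i j. i \<in> A \<Longrightarrow> j \<in> B \<Longrightarrow> i < j"
  shows "ranked_sum w u (A \<union> B) =
    ranked_sum w u A + (\<Sum>j\<in>B. u j * w (card A + card (B \<inter> {..<j})))"
proof -
  have disj: "A \<inter> B = {}" using less by fastforce
  have "(A \<union> B) \<inter> {..<i} = A \<inter> {..<i}" if "i \<in> A" for i
    using less[OF that] by fastforce
  moreover have "card ((A \<union> B) \<inter> {..<j}) = card A + card (B \<inter> {..<j})" if "j \<in> B" for j
  proof -
    have "(A \<union> B) \<inter> {..<j} = A \<union> (B \<inter> {..<j})" using less that by auto
    moreover have "A \<inter> (B \<inter> {..<j}) = {}" using disj by auto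
    ultimately show ?thesis using assms by (simp add: card_Un_disjoint)
  qed
  ultimately show ?thesis
    using assms disj by (simp add: ranked_sum_def sum.union_disjoint)
qed

section \<open>Weights and their partial sums\<close>

locale garling_weight =
  fixes w :: "nat \<Rightarrow> real"
  assumes weight: "w \<in> garling_weights"
begin

lemma w_pos: "0 < w i" and w_0: "w 0 = 1" and w_lim: "w \<longlonglongrightarrow> 0"
  and w_antimono: "i \<le> j \<Longrightarrow> w j \<le> w i"
  using weight by (auto simp: garling_weights_def decseq_def)

lemma w_nonneg: "0 \<le> w i"
  using w_pos[of i] by simp

definition W :: "nat \<Rightarrow> real" where "W n = (\<Sum>k<n. w k)"

lemma W_mono: "m \<le> n \<Longrightarrow> W m \<le> W n"
  unfolding W_def by (intro sum_mono2) (auto simp: w_nonneg)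

lemma W_nonneg: "0 \<le> W n"
  unfolding W_def by (intro sum_nonneg) (auto simp: w_nonneg)

lemma W_ge_1:
  assumes "0 < n"
  shows "1 \<le> W n"
  using W_mono[of 1 n] assms by (simp add: W_def w_0)

lemma W_unbounded: "\<exists>n. c \<le> W n"
proof (rule ccontr)
  assume "\<nexists>n. c \<le> W n"
  then have "(\<Sum>k<n. norm (w k)) \<le> c" for n
    using w_nonneg unfolding W_def by (auto simp: not_le intro: less_imp_le)
  then have "summable (\<lambda>k. norm (w k))"
    by (intro bounded_imp_summable[where B = c])
       (auto, metis lessThan_Suc_atMost)
  then show False using weight by (simp add: garling_weights_def)
qed

text \<open>The Cesaro means of a null sequence tend to 0. Hence a mass that is linear in the number
  of copies outgrows any multiple of \<open>W\<close> at a suitable length.\<close>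

lemma W_sublinear:
  fixes \<epsilon> :: real
  assumes "0 < \<epsilon>"
  shows "\<exists>n>0. W n \<le> \<epsilon> * n"
proof -
  obtain m where m: "\<And>k. k \<ge> m \<Longrightarrow> w k < \<epsilon> / 2"
    using LIMSEQ_D[OF w_lim, of "\<epsilon> / 2"] assms w_nonneg by auto
  obtain n :: nat where n: "2 * W m / \<epsilon> < n" using reals_Archimedean2 by blast
  define N where "N = Suc (max m n)"
  have "W N = W m + (\<Sum>k=m..<N. w k)"
    unfolding W_def lessThan_atLeast0 by (rule sum.atLeastLessThan_concat[symmetric]) (auto simp: N_def)
  also have "(\<Sum>k=m..<N. w k) \<le> (\<Sum>k=m..<N. \<epsilon> / 2)"
    using m by (intro sum_mono) (auto intro: less_imp_le)
  also have "\<dots> \<le> N * (\<epsilon> / 2)"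
    using assms by (simp add: mult_right_mono)
  also have "W m \<le> N * (\<epsilon> / 2)"
  proof -
    have "W m \<le> n * (\<epsilon> / 2)" using n assms by (simp add: field_simps)
    also have "\<dots> \<le> N * (\<epsilon> / 2)" using assms by (intro mult_right_mono) (auto simp: N_def)
    finally show ?thesis .
  qed
  finally show ?thesis by (intro exI[of _ N]) (auto simp: N_def algebra_simps)
qed

section \<open>The functional \<Phi> and its estimates\<close>

abbreviation S :: "(nat \<Rightarrow> real) \<Rightarrow> nat set \<Rightarrow> real" where "S \<equiv> ranked_sum w"
abbreviation \<Phi> :: "(nat \<Rightarrow> real) \<Rightarrow> ennreal" where "\<Phi> \<equiv> garling_mass w"

lemma S_mono:
  assumes "\<And>i. i \<in> A \<Longrightarrow> u i \<le> v i"
  shows "S u A \<le> S v A"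
  unfolding ranked_sum_def by (intro sum_mono mult_right_mono assms w_nonneg)

text \<open>Deleting terms with value 0 can only lower the ranks of the remaining ones, and
  \<open>w\<close> is non-increasing.\<close>

lemma S_le_restrict:
  assumes "finite A" and nonneg: "\<And>i. i \<in> A \<Longrightarrow> 0 \<le> u i"
    and zero: "\<And>i. i \<in> A \<Longrightarrow> i \<notin> B \<Longrightarrow> u i = 0"
  shows "S u A \<le> S u (A \<inter> B)"
proof -
  have "S u A = (\<Sum>i\<in>A \<inter> B. u i * w (card (A \<inter> {..<i})))"
    unfolding ranked_sum_def using assms by (intro sum.mono_neutral_right) auto
  also have "\<dots> \<le> S u (A \<inter> B)"
    unfolding ranked_sum_def
    by (intro sum_mono mult_left_mono w_antimono card_mono nonneg) (use assms in auto)
  finally show ?thesis .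
qed

lemma S_le_const:
  assumes "finite A" and nonneg: "\<And>i. i \<in> A \<Longrightarrow> 0 \<le> u i" and le: "\<And>i. i \<in> A \<Longrightarrow> u i \<le> c"
    and card: "card {i\<in>A. u i \<noteq> 0} \<le> n" and "0 \<le> c"
  shows "S u A \<le> c * W n"
proof -
  define B where "B = {i\<in>A. u i \<noteq> 0}"
  have "S u A \<le> S u (A \<inter> B)"
    by (rule S_le_restrict) (use assms in \<open>auto simp: B_def\<close>)
  also have "A \<inter> B = B" by (auto simp: B_def)
  also have "S u B \<le> S (\<lambda>_. c) B"
    by (rule S_mono) (auto simp: B_def le)
  also have "\<dots> = c * W (card B)"
    unfolding ranked_sum_def W_def sum_distrib_left[symmetric]
    using assms by (subst sum_rank) (auto simp: B_def)
  also have "\<dots> \<le> c * W n"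
    using card \<open>0 \<le> c\<close> by (intro mult_left_mono W_mono) (auto simp: B_def)
  finally show ?thesis .
qed

lemma \<Phi>_upper: "finite A \<Longrightarrow> ennreal (S u A) \<le> \<Phi> u"
  unfolding garling_mass_def by (rule SUP_upper) auto

lemma \<Phi>_least: "(\<And>A. finite A \<Longrightarrow> ennreal (S u A) \<le> K) \<Longrightarrow> \<Phi> u \<le> K"
  unfolding garling_mass_def by (rule SUP_least) auto

lemma S_le_\<Phi>D: "\<Phi> u \<le> ennreal K \<Longrightarrow> 0 \<le> K \<Longrightarrow> finite A \<Longrightarrow> S u A \<le> K"
  using \<Phi>_upper[of A u] by (meson ennreal_le_iff order_trans)

lemma \<Phi>_mono: "(\<And>i. u i \<le> v i) \<Longrightarrow> \<Phi> u \<le> \<Phi> v"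
  unfolding garling_mass_def by (intro SUP_mono) (auto intro!: bexI ennreal_leI S_mono)

lemma \<Phi>_coord: "ennreal (u i) \<le> \<Phi> u"
  using \<Phi>_upper[of "{i}" u] by (simp add: ranked_sum_def w_0)

lemma \<Phi>_add: "\<Phi> (\<lambda>i. u i + v i) \<le> \<Phi> u + \<Phi> v"
proof (rule \<Phi>_least)
  fix A :: "nat set" assume "finite A"
  have "ennreal (S u A + S v A) \<le> ennreal (S u A) + ennreal (S v A)"
    by (cases "0 \<le> S u A"; cases "0 \<le> S v A")
       (auto simp: ennreal_neg intro: ennreal_leI)
  also have "\<dots> \<le> \<Phi> u + \<Phi> v" using \<open>finite A\<close> by (intro add_mono \<Phi>_upper)
  finally show "ennreal (S (\<lambda>i. u i + v i) A) \<le> \<Phi> u + \<Phi> v" by (simp add: ranked_sum_add)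
qed

lemma \<Phi>_0 [simp]: "\<Phi> (\<lambda>_. 0) = 0"
  using \<Phi>_least[of "\<lambda>_. 0" 0] by (simp add: ranked_sum_def)

lemma \<Phi>_sum: "\<Phi> (\<lambda>i. \<Sum>j\<in>J. u j i) \<le> (\<Sum>j\<in>J. \<Phi> (u j))"
proof (induction J rule: infinite_finite_induct)
  case (insert j J)
  then show ?case
    using \<Phi>_add[of "u j" "\<lambda>i. \<Sum>j\<in>J. u j i"] by (simp add: add_left_mono order_trans)
qed auto

lemma \<Phi>_scale_le:
  assumes "0 \<le> c"
  shows "\<Phi> (\<lambda>i. c * u i) \<le> ennreal c * \<Phi> u"
proof (rule \<Phi>_least)
  fix A :: "nat set" assume "finite A"
  then show "ennreal (S (\<lambda>i. c * u i) A) \<le> ennreal c * \<Phi> u"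
    using assms by (simp add: ranked_sum_scale ennreal_mult' mult_left_mono \<Phi>_upper)
qed

lemma \<Phi>_scale:
  assumes "0 \<le> c"
  shows "\<Phi> (\<lambda>i. c * u i) = ennreal c * \<Phi> u"
proof (cases "c = 0")
  case False
  \<comment> \<open>The reverse inequality is the same bound applied with the factor
    \<open>1 / c\<close>.\<close>
  have "ennreal c * \<Phi> u \<le> ennreal c * (ennreal (1 / c) * \<Phi> (\<lambda>i. c * u i))"
    using \<Phi>_scale_le[of "1 / c" "\<lambda>i. c * u i"] False assms by (intro mult_left_mono) auto
  also have "\<dots> = \<Phi> (\<lambda>i. c * u i)"
    using False assms by (simp add: mult.assoc[symmetric] ennreal_mult[symmetric])
  finally show ?thesis using \<Phi>_scale_le[OF assms] by (simp add: antisym)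
qed auto

text \<open>Monotonicity of \<psi> is asked on the support alone, because zero terms are deleted
  before the finite set is moved; elsewhere \<psi> may be arbitrary.\<close>

lemma \<Phi>_spread:
  assumes nonneg: "\<And>i. 0 \<le> u i" and mono: "strict_mono_on {i. u i \<noteq> 0} \<psi>"
    and le: "\<And>i. u i \<noteq> 0 \<Longrightarrow> u i \<le> v (\<psi> i)"
  shows "\<Phi> u \<le> \<Phi> v"
proof (rule \<Phi>_least)
  fix A :: "nat set" assume "finite A"
  define B where "B = A \<inter> {i. u i \<noteq> 0}"
  have "S u A \<le> S u B"
    unfolding B_def using \<open>finite A\<close> nonneg by (intro S_le_restrict) auto
  also have "\<dots> \<le> S (\<lambda>i. v (\<psi> i)) B" by (rule S_mono) (auto simp: B_def le)
  also have "\<dots> = S v (\<psi> ` B)"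
    by (rule ranked_sum_image[symmetric])
       (rule monotone_on_subset[OF mono], auto simp: B_def)
  finally show "ennreal (S u A) \<le> \<Phi> v"
    using \<open>finite A\<close> \<Phi>_upper[of "\<psi> ` B" v]
    by (auto simp: B_def intro: order_trans ennreal_leI)
qed

lemma \<Phi>_le_card:
  assumes nonneg: "\<And>i. 0 \<le> u i" and le: "\<And>i. u i \<le> c"
    and supp: "finite {i. u i \<noteq> 0}" "card {i. u i \<noteq> 0} \<le> n"
  shows "\<Phi> u \<le> ennreal (c * W n)"
proof (rule \<Phi>_least)
  fix A :: "nat set" assume A: "finite A"
  have "card {i\<in>A. u i \<noteq> 0} \<le> card {i. u i \<noteq> 0}"
    using supp by (intro card_mono) auto
  moreover have "0 \<le> c" using nonneg[of 0] le[of 0] by linarith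
  ultimately have "S u A \<le> c * W n"
    using A nonneg le supp by (intro S_le_const) auto
  then show "ennreal (S u A) \<le> ennreal (c * W n)" by (rule ennreal_leI)
qed

lemma \<Phi>_finite_support:
  assumes nonneg: "\<And>i. 0 \<le> u i" and fin: "finite {i. u i \<noteq> 0}"
  shows "\<Phi> u < \<infinity>"
proof -
  define c where "c = (\<Sum>i | u i \<noteq> 0. u i)"
  have "u i \<le> c" for i
  proof (cases "u i = 0")
    case True then show ?thesis using nonneg by (auto simp: c_def intro: sum_nonneg)
  next
    case False then show ?thesis unfolding c_def using fin nonneg by (intro member_le_sum) auto
  qed
  then have "\<Phi> u \<le> ennreal (c * W (card {i. u i \<noteq> 0}))"
    by (intro \<Phi>_le_card assms) auto
  then show ?thesis by (simp add: le_less_trans)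
qed

end

section \<open>Disjointly supported sequences in solid spaces\<close>

abbreviation partial_sum ::
  "(nat \<Rightarrow> 'k::real_normed_field) \<Rightarrow> (nat \<Rightarrow> nat \<Rightarrow> 'k) \<Rightarrow> nat \<Rightarrow> nat \<Rightarrow> 'k" where
  "partial_sum b x n \<equiv> (\<Sum>j<n. seq_scale (b j) (x j))"

lemma sum_seq_apply: "(\<Sum>j\<in>J. f j) i = (\<Sum>j\<in>J. f j i)"
  for f :: "'a \<Rightarrow> nat \<Rightarrow> 'k::real_normed_field"
  by (induction J rule: infinite_finite_induct) auto

lemma partial_sum_apply: "partial_sum b x n i = (\<Sum>j<n. b j * x j i)"
  by (simp add: sum_seq_apply seq_scale_def)

lemma in_span_partial_sum:
  assumes "u \<in> seq.span (range x)"
  shows "\<exists>b n. u = partial_sum b x n"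
  using assms
proof (induction rule: seq.span_induct_alt)
  case base
  then show ?case by (intro exI[of _ "\<lambda>_. 0"] exI[of _ 0]) simp
next
  case (step c v u)
  then obtain k b n where k: "v = x k" and u: "u = partial_sum b x n" by auto
  \<comment> \<open>\<open>b\<close> is cut off at \<open>n\<close> first: its values from
    \<open>n\<close> on never entered \<open>u\<close>, and \<open>k\<close> may be \<open>n\<close>
    or larger.\<close>
  define b' where "b' = (\<lambda>j. (if j < n then b j else 0) + (if j = k then c else 0))"
  have "(seq_scale c v + u) i = partial_sum b' x (max n (Suc k)) i" for i
  proof -
    have "(\<Sum>j<max n (Suc k). (if j < n then b j else 0) * x j i) = (\<Sum>j<n. b j * x j i)"
      by (intro sum.mono_neutral_cong_right) auto
    moreover have "(\<Sum>j<max n (Suc k). (if j = k then c else 0) * x j i) = c * x k i"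
      by (subst sum.mono_neutral_cong_right[of _ "{k}" _ "\<lambda>j. c * x j i"]) auto
    ultimately show ?thesis
      by (simp add: u k partial_sum_apply b'_def distrib_right sum.distrib seq_scale_def sum_seq_apply)
  qed
  then show ?case by blast
qed

lemma partial_sum_in_span: "partial_sum b x n \<in> seq.span (range x)"
  by (intro seq.span_sum seq.span_scale seq.span_base) auto

text \<open>Terms are required to be nonzero so that each coefficient can be recovered from the
  vector.\<close>

definition disjoint_seqs :: "(nat \<Rightarrow> nat \<Rightarrow> 'k::real_normed_field) \<Rightarrow> bool" where
  "disjoint_seqs x \<longleftrightarrow> (\<forall>j. x j \<noteq> 0) \<and> (\<forall>i j k. x j i \<noteq> 0 \<longrightarrow> x k i \<noteq> 0 \<longrightarrow> j = k)"

lemma disjoint_seqs_comp: "disjoint_seqs x \<Longrightarrow> inj f \<Longrightarrow> disjoint_seqs (x \<circ> f)"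
  by (fastforce simp: disjoint_seqs_def inj_def)

lemma partial_sum_disjoint:
  assumes "disjoint_seqs x"
  shows "x j i \<noteq> 0 \<Longrightarrow> partial_sum b x n i = (if j < n then b j * x j i else 0)"
    and "(\<And>j. x j i = 0) \<Longrightarrow> partial_sum b x n i = 0"
proof -
  assume ji: "x j i \<noteq> 0"
  have "b k * x k i = (if k = j then b j * x j i else 0)" for k
    using assms ji by (auto simp: disjoint_seqs_def)
  then show "partial_sum b x n i = (if j < n then b j * x j i else 0)"
    by (simp add: partial_sum_apply)
qed (simp add: partial_sum_apply)

text \<open>Properties of a quasi-normed sequence lattice through which closed spans are treated
  coordinatewise: \<open>solid\<close> gives monotonicity in absolute values,
  \<open>coord_le\<close> continuity of the coordinates, and \<open>fatou\<close> recovers a vector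
  and its bound from the finite sections.\<close>

locale solid_space =
  fixes X :: "(nat \<Rightarrow> 'k::real_normed_field) set" and N :: "(nat \<Rightarrow> 'k) \<Rightarrow> real"
  assumes zero_in: "0 \<in> X" and N_zero: "N 0 = 0"
    and diff_in: "u \<in> X \<Longrightarrow> v \<in> X \<Longrightarrow> u - v \<in> X"
    and scale_in: "v \<in> X \<Longrightarrow> seq_scale c v \<in> X"
    and solid: "v \<in> X \<Longrightarrow> (\<And>i. norm (u i) \<le> norm (v i)) \<Longrightarrow> u \<in> X \<and> N u \<le> N v"
    and coord_le: "v \<in> X \<Longrightarrow> norm (v i) \<le> N v"
    and fatou: "(\<And>A. finite A \<Longrightarrow> (\<lambda>i. if i \<in> A then v i else 0) \<in> X \<and>
        N (\<lambda>i. if i \<in> A then v i else 0) \<le> K) \<Longrightarrow> v \<in> X \<and> N v \<le> K"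
begin

lemma N_nonneg: "v \<in> X \<Longrightarrow> 0 \<le> N v"
  using coord_le[of v 0] norm_ge_zero order_trans by blast

lemma add_in: "u \<in> X \<Longrightarrow> v \<in> X \<Longrightarrow> u + v \<in> X"
  using diff_in[of u "0 - v"] diff_in[of 0 v] zero_in by simp

lemma span_in:
  assumes "range x \<subseteq> X" "u \<in> seq.span (range x)"
  shows "u \<in> X"
  using assms(2)
proof (induction rule: seq.span_induct_alt)
  case base
  show ?case by (rule zero_in)
next
  case (step c v u)
  then show ?case using assms(1) by (intro add_in scale_in) auto
qed

lemma partial_sum_in: "range x \<subseteq> X \<Longrightarrow> partial_sum b x n \<in> X"
  by (rule span_in[OF _ partial_sum_in_span])

lemma span_subset_closed_span: "range x \<subseteq> X \<Longrightarrow> seq.span (range x) \<subseteq> closed_span X N x"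
  unfolding closed_span_def
  by (smt (verit, ccfv_SIG) N_zero diff_self mem_Collect_eq span_in subset_iff)

section \<open>Expansions along a disjointly supported sequence\<close>

context
  fixes x :: "nat \<Rightarrow> nat \<Rightarrow> 'k"
  assumes x_in: "range x \<subseteq> X" and x_disj: "disjoint_seqs x"
begin

text \<open>The point of the support of \<open>x j\<close> at which the coefficient of
  \<open>x j\<close> is read off.\<close>

definition pivot :: "nat \<Rightarrow> nat" where "pivot j = (SOME i. x j i \<noteq> 0)"

definition coeff :: "(nat \<Rightarrow> 'k) \<Rightarrow> nat \<Rightarrow> 'k" where "coeff v j = v (pivot j) / x j (pivot j)"

lemma pivot: "x j (pivot j) \<noteq> 0"
  using someI_ex[of "\<lambda>i. x j i \<noteq> 0"] x_disj
  unfolding pivot_def disjoint_seqs_def by (auto simp: fun_eq_iff)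

text \<open>Both relations hold for finite linear combinations and pass to the closure because
  \<open>coord_le\<close> makes the coordinates continuous.\<close>

lemma closed_span_coord:
  assumes v: "v \<in> closed_span X N x"
  shows "x j i \<noteq> 0 \<Longrightarrow> v i = coeff v j * x j i"
    and "(\<And>j. x j i = 0) \<Longrightarrow> v i = 0"
proof -
  have approx: "\<exists>b n. \<forall>i. norm (v i - partial_sum b x n i) \<le> \<epsilon>" if \<epsilon>: "\<epsilon> > 0" for \<epsilon>
  proof -
    obtain u where u: "u \<in> seq.span (range x)" "N (v - u) < \<epsilon>"
      using v \<epsilon> unfolding closed_span_def by blast
    obtain b n where "u = partial_sum b x n" using in_span_partial_sum[OF u(1)] by blast
    moreover have "v - u \<in> X"
      using v u x_in span_in by (intro diff_in) (auto simp: closed_span_def)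
    ultimately show ?thesis
      using u(2) coord_le[of "v - u"]
      by (metis less_imp_le minus_apply order_trans)
  qed
  {
    assume ji: "x j i \<noteq> 0"
    let ?k = "pivot j"
    \<comment> \<open>The claim in cross-multiplied form. The expression vanishes for partial sums,
      so only the approximation errors at \<open>i\<close> and \<open>?k\<close> remain.\<close>
    have "norm (v i * x j ?k - v ?k * x j i) \<le> 0 + \<delta>" if \<delta>: "\<delta> > 0" for \<delta>
    proof -
      let ?c = "norm (x j ?k) + norm (x j i)"
      have c: "?c > 0" using pivot[of j] by (simp add: add_pos_nonneg)
      obtain b n where b: "\<And>i. norm (v i - partial_sum b x n i) \<le> \<delta> / ?c"
        using approx[OF divide_pos_pos[OF \<delta> c]] by auto
      have "v i * x j ?k - v ?k * x j i =
          (v i - partial_sum b x n i) * x j ?k - (v ?k - partial_sum b x n ?k) * x j i"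
        using partial_sum_disjoint(1)[OF x_disj ji, of b n]
          partial_sum_disjoint(1)[OF x_disj pivot, of b n j] by (simp add: algebra_simps)
      also have "norm \<dots> \<le> \<delta> / ?c * norm (x j ?k) + \<delta> / ?c * norm (x j i)"
        by (intro order_trans[OF norm_triangle_ineq4] add_mono)
           (simp_all only: norm_mult, (intro mult_right_mono b norm_ge_zero)+)
      also have "\<dots> = \<delta>" using c by (simp only: distrib_left[symmetric]) simp
      finally show ?thesis by simp
    qed
    then have "norm (v i * x j ?k - v ?k * x j i) \<le> 0" by (rule field_le_epsilon)
    then show "v i = coeff v j * x j i"
      using pivot[of j] by (simp add: coeff_def field_simps)
  }
  {
    assume zero: "\<And>j. x j i = 0"
    have "norm (v i) \<le> 0 + \<delta>" if "\<delta> > 0" for \<delta>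
      using approx[OF that] partial_sum_disjoint(2)[OF x_disj zero]
      by (metis add_0 diff_zero)
    then have "norm (v i) \<le> 0" by (rule field_le_epsilon)
    then show "v i = 0" by simp
  }
qed

lemma expansion_tendsto:
  assumes v: "v \<in> closed_span X N x"
  shows "(\<lambda>n. N (v - partial_sum (coeff v) x n)) \<longlonglongrightarrow> 0"
proof (rule LIMSEQ_I)
  fix \<epsilon> :: real assume "\<epsilon> > 0"
  then obtain u where u: "u \<in> seq.span (range x)" "N (v - u) < \<epsilon>"
    using v unfolding closed_span_def by blast
  obtain b m where b: "u = partial_sum b x m" using in_span_partial_sum[OF u(1)] by blast
  have vu: "v - u \<in> X"
    using v u x_in span_in by (intro diff_in) (auto simp: closed_span_def)
  have "norm (N (v - partial_sum (coeff v) x n) - 0) < \<epsilon>" if "n \<ge> m" for n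
  proof -
    \<comment> \<open>On the support of \<open>x j\<close> the remainder is 0 if
      \<open>j < n\<close>; if \<open>n \<le> j\<close> it equals \<open>v\<close>, and
      \<open>u\<close> vanishes there because \<open>m \<le> n\<close>. Solidity then compares it
      with the chosen approximation.\<close>
    have "norm ((v - partial_sum (coeff v) x n) i) \<le> norm ((v - u) i)" for i
    proof (cases "\<exists>j. x j i \<noteq> 0")
      case True
      then obtain j where j: "x j i \<noteq> 0" by blast
      show ?thesis
        using closed_span_coord(1)[OF v j] partial_sum_disjoint(1)[OF x_disj j] that
        by (auto simp: b)
    next
      case False
      then show ?thesis
        using closed_span_coord(2)[OF v] partial_sum_disjoint(2)[OF x_disj] by auto
    qed
    then have "v - partial_sum (coeff v) x n \<in> X" "N (v - partial_sum (coeff v) x n) \<le> N (v - u)"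
      using solid[OF vu] by blast+
    then show ?thesis using u(2) N_nonneg by auto
  qed
  then show "\<exists>m. \<forall>n\<ge>m. norm (N (v - partial_sum (coeff v) x n) - 0) < \<epsilon>" by blast
qed

text \<open>Convergence in \<open>N\<close> forces convergence at each pivot, where the partial sums
  are constant from \<open>Suc j\<close> on.\<close>

lemma expansion_unique:
  assumes v: "v \<in> X" and lim: "(\<lambda>n. N (v - partial_sum b x n)) \<longlonglongrightarrow> 0"
  shows "b = coeff v"
proof
  fix j
  let ?k = "pivot j"
  have "norm (v ?k - b j * x j ?k) \<le> N (v - partial_sum b x n)" if "n > j" for n
    using coord_le[OF diff_in[OF v partial_sum_in[OF x_in]], of b n ?k] that
      partial_sum_disjoint(1)[OF x_disj pivot, of b n j] by simp
  then have "norm (v ?k - b j * x j ?k) \<le> 0"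
    by (intro LIMSEQ_le_const[OF lim]) (auto intro!: exI[of _ "Suc j"])
  then show "b j = coeff v j"
    using pivot[of j] by (simp add: coeff_def field_simps)
qed

lemma basic_sequence_disjoint: "basic_sequence X N x"
  unfolding basic_sequence_def
proof (intro conjI ballI x_in)
  fix v assume v: "v \<in> closed_span X N x"
  then have "v \<in> X" by (simp add: closed_span_def)
  then show "\<exists>!a. (\<lambda>n. N (v - partial_sum a x n)) \<longlonglongrightarrow> 0"
    using expansion_tendsto[OF v] expansion_unique by blast
qed

lemma coeff_add: "coeff (u + v) j = coeff u j + coeff v j"
  and coeff_scale: "coeff (seq_scale c v) j = c * coeff v j"
  by (auto simp: coeff_def seq_scale_def add_divide_distrib)

lemma coeff_basis: "coeff (x k) j = (if j = k then 1 else 0)"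
  using pivot[of j] x_disj by (auto simp: coeff_def disjoint_seqs_def)

text \<open>The partial sums of the expansion are restrictions of \<open>v\<close> to unions of
  supports, so \<open>solid\<close> applies.\<close>

lemma partial_sum_coeff_le:
  assumes v: "v \<in> closed_span X N x"
  shows "N (partial_sum (coeff v) x n) \<le> N v"
proof -
  have "norm (partial_sum (coeff v) x n i) \<le> norm (v i)" for i
  proof (cases "\<exists>j. x j i \<noteq> 0")
    case True
    then obtain j where j: "x j i \<noteq> 0" by blast
    show ?thesis
      using closed_span_coord(1)[OF v j] partial_sum_disjoint(1)[OF x_disj j] by auto
  next
    case False
    then show ?thesis using partial_sum_disjoint(2)[OF x_disj] by auto
  qed
  then show ?thesis using solid v unfolding closed_span_def by blast
qed

end

section \<open>Unconditionality and domination\<close>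

lemma unconditional_disjoint:
  assumes "range x \<subseteq> X" "disjoint_seqs x"
  shows "unconditional X N x"
  unfolding unconditional_def
proof (intro allI impI)
  fix \<pi> :: "nat \<Rightarrow> nat" assume "bij \<pi>"
  then show "basic_sequence X N (x \<circ> \<pi>)"
    using assms by (intro basic_sequence_disjoint disjoint_seqs_comp) (auto simp: bij_def)
qed

text \<open>Reduces domination to an inequality between finite combinations. The operator is defined
  coordinatewise, where at most one term is nonzero, and \<open>fatou\<close> carries the bound over
  to infinite expansions.\<close>

lemma dominatesI:
  assumes x_in: "range x \<subseteq> X" and x_disj: "disjoint_seqs x"
    and y_in: "range y \<subseteq> X" and y_disj: "disjoint_seqs y"
    and C: "\<And>b n. N (partial_sum b y n) \<le> C * N (partial_sum b x n)"
  shows "dominates X N x y"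
proof -
  define T where "T v = (\<lambda>i. \<Sum>j | y j i \<noteq> 0. coeff x v j * y j i)" for v
  have T_coord: "T v i = coeff x v j * y j i" if "y j i \<noteq> 0" for v i j
  proof -
    have "{j. y j i \<noteq> 0} = {j}" using that y_disj by (auto simp: disjoint_seqs_def)
    then show ?thesis by (simp add: T_def)
  qed
  have T_coord0: "T v i = 0" if "\<And>j. y j i = 0" for v i
    using that by (simp add: T_def)
  have T_add: "T (u + v) = T u + T v" for u v
    by (auto simp: T_def coeff_add[OF x_in x_disj] distrib_right sum.distrib)
  have T_scale: "T (seq_scale c v) = seq_scale c (T v)" for c v
    unfolding T_def coeff_scale[OF x_in x_disj]
    by (simp add: seq_scale_def sum_distrib_left mult.assoc)
  have T_basis: "T (x k) = y k" for k
  proof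
    fix i show "T (x k) i = y k i"
    proof (cases "\<exists>j. y j i \<noteq> 0")
      case True
      then obtain j where j: "y j i \<noteq> 0" by blast
      then show ?thesis
        using y_disj by (auto simp: T_coord[OF j] coeff_basis[OF x_in x_disj] disjoint_seqs_def)
    next
      case False then show ?thesis using T_coord0 by auto
    qed
  qed
  \<comment> \<open>\<open>C\<close> may be negative; \<open>max C 0\<close> allows multiplication
    of inequalities between norms.\<close>
  have T_bound: "T v \<in> X \<and> N (T v) \<le> max C 0 * N v" if v: "v \<in> closed_span X N x" for v
  proof (rule fatou)
    fix A :: "nat set" assume A: "finite A"
    \<comment> \<open>Beyond every index \<open>j\<close> for which the support of
      \<open>y j\<close> meets \<open>A\<close>, so that on \<open>A\<close> the vector
      \<open>T v\<close> agrees with a partial sum. \<open>insert 0\<close> covers the case that no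
      support meets \<open>A\<close>.\<close>
    define n where "n = Suc (Max (insert 0 {j. \<exists>i\<in>A. y j i \<noteq> 0}))"
    have "{j. \<exists>i\<in>A. y j i \<noteq> 0} = (\<Union>i\<in>A. {j. y j i \<noteq> 0})" by auto
    moreover have "finite {j. y j i \<noteq> 0}" for i
    proof (cases "\<exists>j. y j i \<noteq> 0")
      case True
      then obtain j where "y j i \<noteq> 0" by blast
      then have "{j. y j i \<noteq> 0} \<subseteq> {j}" using y_disj by (auto simp: disjoint_seqs_def)
      then show ?thesis by (rule finite_subset) simp
    qed simp
    ultimately have fin: "finite {j. \<exists>i\<in>A. y j i \<noteq> 0}" using A by auto
    have n: "j < n" if "i \<in> A" "y j i \<noteq> 0" for i j
      using that fin by (auto simp: n_def less_Suc_eq_le intro!: Max_ge)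
    have eq: "norm (if i \<in> A then T v i else 0) \<le> norm (partial_sum (coeff x v) y n i)" for i
    proof (cases "\<exists>j. y j i \<noteq> 0")
      case True
      then obtain j where j: "y j i \<noteq> 0" by blast
      then show ?thesis using n[of i j] partial_sum_disjoint(1)[OF y_disj j]
        by (auto simp: T_coord[OF j])
    next
      case False then show ?thesis using T_coord0 by auto
    qed
    have "(\<lambda>i. if i \<in> A then T v i else 0) \<in> X \<and>
        N (\<lambda>i. if i \<in> A then T v i else 0) \<le> N (partial_sum (coeff x v) y n)"
      by (rule solid[OF partial_sum_in[OF y_in] eq])
    moreover have "N (partial_sum (coeff x v) y n) \<le> max C 0 * N v"
    proof -
      have "N (partial_sum (coeff x v) y n) \<le> C * N (partial_sum (coeff x v) x n)" by (rule C)
      also have "\<dots> \<le> max C 0 * N (partial_sum (coeff x v) x n)"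
        by (intro mult_right_mono N_nonneg partial_sum_in x_in) auto
      also have "\<dots> \<le> max C 0 * N v"
        by (intro mult_left_mono partial_sum_coeff_le x_in x_disj v) auto
      finally show ?thesis .
    qed
    ultimately show "(\<lambda>i. if i \<in> A then T v i else 0) \<in> X \<and>
        N (\<lambda>i. if i \<in> A then T v i else 0) \<le> max C 0 * N v" by simp
  qed
  have T_zero: "T 0 = 0" using T_scale[of 0 0] unfolding seq.scale_zero_left .
  have T_sum: "T (partial_sum b x n) = partial_sum b y n" for b n
  proof (induction n)
    case 0
    show ?case by (simp only: lessThan_0 sum.empty T_zero)
  next
    case (Suc n)
    then show ?case unfolding sum.lessThan_Suc T_add T_scale T_basis by (rule arg_cong)
  qed
  have T_closed: "T v \<in> closed_span X N y" if v: "v \<in> closed_span X N x" for v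
    unfolding closed_span_def
  proof (intro CollectI conjI allI impI)
    show "T v \<in> X" using T_bound[OF v] by simp
    fix \<epsilon> :: real assume "\<epsilon> > 0"
    then have "\<epsilon> / (max C 0 + 1) > 0" by (simp add: add_nonneg_pos)
    then obtain u where u: "u \<in> seq.span (range x)" "N (v - u) < \<epsilon> / (max C 0 + 1)"
      using v unfolding closed_span_def by blast
    obtain b n where b: "u = partial_sum b x n" using in_span_partial_sum[OF u(1)] by blast
    have "v - u \<in> closed_span X N x"
      unfolding closed_span_def
    proof (intro CollectI conjI allI impI)
      show "v - u \<in> X"
        using v u x_in span_in by (intro diff_in) (auto simp: closed_span_def)
      fix \<epsilon>' :: real assume "\<epsilon>' > 0"
      then obtain u' where "u' \<in> seq.span (range x)" "N (v - u') < \<epsilon>'"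
        using v unfolding closed_span_def by blast
      then show "\<exists>u'\<in>seq.span (range x). N (v - u - u') < \<epsilon>'"
        using u(1) by (intro bexI[of _ "u' - u"]) (auto intro: seq.span_diff)
    qed
    then have "N (T (v - u)) \<le> max C 0 * N (v - u)" "0 \<le> N (v - u)"
      using T_bound N_nonneg by (auto simp: closed_span_def)
    moreover have "T (v - u) = T v - partial_sum b y n"
      using T_add[of "v - u" u] T_sum[of b n] by (simp add: b)
    ultimately have "N (T v - partial_sum b y n) \<le> (max C 0 + 1) * N (v - u)"
      by (simp add: distrib_right)
    also have "\<dots> < \<epsilon>" using u(2) by (simp add: field_simps add_pos_nonneg)
    finally show "\<exists>u\<in>seq.span (range y). N (T v - u) < \<epsilon>"
      using partial_sum_in_span by blast
  qed
  show ?thesis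
    unfolding dominates_def
    using T_closed T_add T_scale T_bound T_basis
    by (intro exI[of _ T] conjI exI[of _ "max C 0"] ballI allI image_subsetI) auto
qed

lemma dominatesD:
  assumes x_in: "range x \<subseteq> X" and dom: "dominates X N x y"
  obtains C where "\<And>b n. N (partial_sum b y n) \<le> C * N (partial_sum b x n)"
proof -
  obtain T C where
    add: "\<And>u v. u \<in> closed_span X N x \<Longrightarrow> v \<in> closed_span X N x \<Longrightarrow> T (u + v) = T u + T v"
    and scale: "\<And>c v. v \<in> closed_span X N x \<Longrightarrow> T (seq_scale c v) = seq_scale c (T v)"
    and C: "\<And>v. v \<in> closed_span X N x \<Longrightarrow> N (T v) \<le> C * N v"
    and basis: "\<And>j. T (x j) = y j"
    using dom unfolding dominates_def by metis
  have in_span: "u \<in> closed_span X N x" if "u \<in> seq.span (range x)" for u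
    using span_subset_closed_span[OF x_in] that by blast
  have "T (partial_sum b x n) = partial_sum b y n" for b n
  proof (induction n)
    case 0
    \<comment> \<open>Homogeneity is available on the closed span, which contains 0; scaling by 0
      gives \<open>T 0 = 0\<close>.\<close>
    have "T (seq_scale 0 0) = seq_scale 0 (T 0)"
      by (rule scale) (rule in_span, rule seq.span_zero)
    then show ?case by (simp only: lessThan_0 sum.empty seq.scale_zero_left)
  next
    case (Suc n)
    have "T (partial_sum b x n + seq_scale (b n) (x n)) =
        T (partial_sum b x n) + T (seq_scale (b n) (x n))"
      by (intro add in_span partial_sum_in_span seq.span_scale seq.span_base) auto
    also have "T (seq_scale (b n) (x n)) = seq_scale (b n) (y n)"
      using scale[of "x n" "b n"] in_span[OF seq.span_base] basis by simp
    finally show ?case using Suc by simp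
  qed
  then have "N (partial_sum b y n) \<le> C * N (partial_sum b x n)" for b n
    using C[OF in_span[OF partial_sum_in_span[of b x n]]] by simp
  then show thesis by (rule that)
qed

lemma dominates_refl: "dominates X N x x"
  unfolding dominates_def by (intro exI[of _ "\<lambda>v. v"] conjI) (auto intro: exI[of _ 1])

end

section \<open>The Garling space as a solid space\<close>

text \<open>Passing to p-th powers turns the Garling quasi-norm into \<Phi>, which is sublinear
  whatever the exponent.\<close>

definition pmass :: "real \<Rightarrow> (nat \<Rightarrow> 'k::real_normed_field) \<Rightarrow> nat \<Rightarrow> real" where
  "pmass p x i = norm (x i) powr p"

text \<open>At most one term is nonzero at each coordinate, so the p-th powers add up
  exactly.\<close>

lemma pmass_partial_sum:
  assumes "disjoint_seqs x"
  shows "pmass p (partial_sum b x n) i = (\<Sum>j<n. norm (b j) powr p * pmass p (x j) i)"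
proof (cases "\<exists>j. x j i \<noteq> 0")
  case True
  then obtain j where j: "x j i \<noteq> 0" by blast
  have "norm (b k) powr p * pmass p (x k) i =
      (if k = j then norm (b j) powr p * pmass p (x j) i else 0)" for k
    using assms j by (auto simp: disjoint_seqs_def pmass_def)
  then have "(\<Sum>k<n. norm (b k) powr p * pmass p (x k) i) =
      (\<Sum>k<n. if k = j then norm (b j) powr p * pmass p (x j) i else 0)"
    by (rule sum.cong[OF refl])
  then show ?thesis
    using partial_sum_disjoint(1)[OF assms j, of b n]
    by (simp add: pmass_def norm_mult powr_mult)
next
  case False
  then show ?thesis using partial_sum_disjoint(2)[OF assms] by (simp add: pmass_def)
qed

section \<open>Increasing maps and finite sets\<close>

lemma sum_strict_mono_eq_ranked_sum:
  assumes "strict_mono \<phi>"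
  shows "(\<Sum>j<n. u (\<phi> j) * w j) = ranked_sum w u (\<phi> ` {..<n})"
proof -
  have "{..<n} \<inter> {..<j} = {..<j}" if "j < n" for j using that by auto
  then show ?thesis
    using assms by (subst ranked_sum_image)
      (auto simp: ranked_sum_def strict_mono_def strict_mono_on_def intro!: sum.cong)
qed

lemma ranked_sum_eq_sum_strict_mono:
  fixes A :: "nat set"
  assumes "finite A"
  obtains \<phi> J where "strict_mono \<phi>" "finite J" "ranked_sum w u A = (\<Sum>j\<in>J. u (\<phi> j) * w j)"
proof -
  obtain k where k: "A \<subseteq> {..<k}" using assms finite_nat_iff_bounded by blast
  \<comment> \<open>Adding everything from \<open>k\<close> on makes \<open>A\<close> the beginning
    of an infinite set, whose enumeration is the required map. The indices of \<open>A\<close> then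
    form an initial segment, so that index and rank agree.\<close>
  define B where "B = A \<union> {k..}"
  have inf: "infinite B" by (simp add: B_def infinite_Ici)
  define \<phi> where "\<phi> = enumerate B"
  have mono: "strict_mono \<phi>" using strict_mono_enumerate[OF inf] by (simp add: \<phi>_def)
  have range: "range \<phi> = B" using range_enumerate[OF inf] by (simp add: \<phi>_def)
  define J where "J = {j. \<phi> j < k}"
  have A: "A = \<phi> ` J"
  proof
    show "A \<subseteq> \<phi> ` J"
    proof
      fix i assume i: "i \<in> A"
      then have "i \<in> range \<phi>" using range by (simp add: B_def)
      then show "i \<in> \<phi> ` J" using i k by (auto simp: J_def)
    qed
    show "\<phi> ` J \<subseteq> A"
    proof
      fix i assume "i \<in> \<phi> ` J"
      then have "i \<in> B" "i < k" using range by (auto simp: J_def)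
      then show "i \<in> A" by (simp add: B_def)
    qed
  qed
  have inj: "inj_on \<phi> J" using mono by (meson strict_mono_imp_inj_on subset_UNIV inj_on_subset)
  have "J \<inter> {..<j} = {..<j}" if "j \<in> J" for j
    using that mono by (auto simp: J_def) (meson strict_mono_less less_trans)
  then have "ranked_sum w u A = (\<Sum>j\<in>J. u (\<phi> j) * w j)"
    unfolding A using mono
    by (subst ranked_sum_image) (auto simp: ranked_sum_def strict_mono_def strict_mono_on_def)
  moreover have "finite J" using assms inj unfolding A by (rule finite_imageD)
  ultimately show thesis using mono that by blast
qed

locale garling = garling_weight +
  fixes p :: real
  assumes p_pos: "0 < p"
begin

abbreviation G :: "(nat \<Rightarrow> 'k::real_normed_field) set" where "G \<equiv> garling_space w p"
abbreviation gnorm :: "(nat \<Rightarrow> 'k::real_normed_field) \<Rightarrow> real" where "gnorm \<equiv> garling_norm w p"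

lemma garling_sum_powr:
  assumes "summable (\<lambda>j. norm (x (\<phi> j)) powr p * w j)"
  shows "garling_sum w p x \<phi> powr p = (\<Sum>j. norm (x (\<phi> j)) powr p * w j)"
proof -
  have "0 \<le> (\<Sum>j. norm (x (\<phi> j)) powr p * w j)"
    using assms by (intro suminf_nonneg) (auto simp: w_nonneg)
  then show ?thesis using p_pos by (simp add: garling_sum_def powr_powr)
qed

lemma garling_sum_le:
  assumes fin: "\<Phi> (pmass p x) \<le> ennreal K" and "0 \<le> K" and \<phi>: "strict_mono \<phi>"
  shows "summable (\<lambda>j. norm (x (\<phi> j)) powr p * w j)" "garling_sum w p x \<phi> \<le> K powr (1 / p)"
proof -
  have le: "(\<Sum>j<n. norm (x (\<phi> j)) powr p * w j) \<le> K" for n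
    using sum_strict_mono_eq_ranked_sum[OF \<phi>, of "pmass p x"] S_le_\<Phi>D[OF fin \<open>0 \<le> K\<close>]
    by (simp add: pmass_def)
  show summable: "summable (\<lambda>j. norm (x (\<phi> j)) powr p * w j)"
    by (rule summableI_nonneg_bounded[OF _ le]) (simp add: w_nonneg)
  show "garling_sum w p x \<phi> \<le> K powr (1 / p)"
    unfolding garling_sum_def using p_pos
    by (intro powr_mono2 suminf_le_const summable le suminf_nonneg) (auto simp: w_nonneg)
qed

text \<open>For the first claim, every finite set is the beginning of an increasing map, and
  dropping the rest of a nonnegative series only lowers its sum.\<close>

lemma \<Phi>_le_norm:
  assumes "x \<in> G"
  shows "\<Phi> (pmass p x) \<le> ennreal (gnorm x powr p)" "0 \<le> gnorm x"
proof -
  have le: "garling_sum w p x \<phi> \<le> gnorm x" if "strict_mono \<phi>" for \<phi>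
    unfolding garling_norm_def using assms that
    by (intro cSUP_upper) (auto simp: garling_space_def)
  have "0 \<le> garling_sum w p x (\<lambda>i. i)" by (simp add: garling_sum_def)
  then show "0 \<le> gnorm x" using le[of "\<lambda>i. i"] by (simp add: strict_mono_def)
  show "\<Phi> (pmass p x) \<le> ennreal (gnorm x powr p)"
  proof (rule \<Phi>_least, rule ennreal_leI)
    fix A :: "nat set" assume "finite A"
    then obtain \<phi> J where \<phi>: "strict_mono \<phi>" and J: "finite J"
      "S (pmass p x) A = (\<Sum>j\<in>J. pmass p x (\<phi> j) * w j)"
      by (rule ranked_sum_eq_sum_strict_mono)
    have summable: "summable (\<lambda>j. norm (x (\<phi> j)) powr p * w j)"
      using assms \<phi> by (simp add: garling_space_def)
    have "S (pmass p x) A \<le> (\<Sum>j. norm (x (\<phi> j)) powr p * w j)"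
      using J sum_le_suminf[OF summable \<open>finite J\<close>] by (simp add: pmass_def w_nonneg)
    also have "\<dots> = garling_sum w p x \<phi> powr p" using garling_sum_powr[of x \<phi>, OF summable] by simp
    also have "\<dots> \<le> gnorm x powr p"
      using le[OF \<phi>] p_pos by (intro powr_mono2) (auto simp: garling_sum_def)
    finally show "S (pmass p x) A \<le> gnorm x powr p" .
  qed
qed

lemma in_G_iff: "x \<in> G \<longleftrightarrow> \<Phi> (pmass p x) < \<infinity>"
proof
  assume "\<Phi> (pmass p x) < \<infinity>"
  then obtain K where "0 \<le> K" "\<Phi> (pmass p x) = ennreal K"
    by (metis ennreal_cases infinity_ennreal_def less_irrefl)
  then show "x \<in> G"
    using garling_sum_le[of x K] by (auto simp: garling_space_def bdd_above_def)
next
  assume "x \<in> G"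
  then show "\<Phi> (pmass p x) < \<infinity>" using \<Phi>_le_norm(1)[of x] by (simp add: le_less_trans)
qed

lemma gnorm_powr:
  assumes "x \<in> G"
  shows "ennreal (gnorm x powr p) = \<Phi> (pmass p x)"
proof -
  obtain K where K: "0 \<le> K" "\<Phi> (pmass p x) = ennreal K"
    using assms unfolding in_G_iff by (metis ennreal_cases infinity_ennreal_def less_irrefl)
  have "(\<lambda>i. i) \<in> {\<phi> :: nat \<Rightarrow> nat. strict_mono \<phi>}" by (simp add: strict_mono_def)
  then have ne: "{\<phi> :: nat \<Rightarrow> nat. strict_mono \<phi>} \<noteq> {}" by blast
  have "gnorm x \<le> K powr (1 / p)"
    unfolding garling_norm_def using garling_sum_le(2)[of x K] K
    by (intro cSUP_least ne) auto
  then have "gnorm x powr p \<le> (K powr (1 / p)) powr p"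
    using \<Phi>_le_norm(2)[OF assms] p_pos by (intro powr_mono2) auto
  then have "gnorm x powr p \<le> K" using K p_pos by (simp add: powr_powr)
  then show ?thesis using \<Phi>_le_norm(1)[OF assms] K by (simp add: antisym ennreal_leI)
qed

lemma gnorm_leI:
  assumes "\<Phi> (pmass p x) \<le> ennreal (K powr p)" "0 \<le> K"
  shows "x \<in> G \<and> gnorm x \<le> K"
proof
  show x: "x \<in> G" using assms by (simp add: in_G_iff le_less_trans)
  have "ennreal (gnorm x powr p) \<le> ennreal (K powr p)" using assms gnorm_powr[OF x] by simp
  then have "gnorm x powr p \<le> K powr p" by simp
  then show "gnorm x \<le> K"
    using powr_less_mono2[OF p_pos, of K "gnorm x"] \<open>0 \<le> K\<close> by linarith
qed

lemma pmass_scale: "pmass p (seq_scale c x) i = norm c powr p * pmass p x i"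
  by (simp add: pmass_def seq_scale_def norm_mult powr_mult)

text \<open>A bound through the larger of the two values is valid for exponents above and below 1
  alike.\<close>

lemma pmass_diff: "pmass p (x - y) i \<le> 2 powr p * (pmass p x i + pmass p y i)"
proof -
  let ?m = "max (norm (x i)) (norm (y i))"
  have "norm (x i - y i) \<le> 2 * ?m"
    using norm_triangle_ineq4[of "x i" "y i"] by linarith
  then have "pmass p (x - y) i \<le> (2 * ?m) powr p"
    using p_pos by (simp add: pmass_def powr_mono2)
  also have "\<dots> = 2 powr p * ?m powr p" by (simp add: powr_mult)
  also have "?m powr p \<le> pmass p x i + pmass p y i" by (simp add: max_def pmass_def)
  finally show ?thesis by simp
qed

text \<open>Singletons give \<open>coord_le\<close>, since \<open>w 0 = 1\<close>;
  \<open>fatou\<close> holds because \<Phi> inspects only finite sets.\<close>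

sublocale solid_space "G :: (nat \<Rightarrow> 'k::real_normed_field) set" gnorm
proof
  have z: "pmass p 0 = (\<lambda>_. 0)" by (auto simp: pmass_def)
  show "(0 :: nat \<Rightarrow> 'k) \<in> G" "gnorm (0 :: nat \<Rightarrow> 'k) = 0"
    using gnorm_leI[of "0 :: nat \<Rightarrow> 'k" 0] \<Phi>_le_norm(2)[of "0 :: nat \<Rightarrow> 'k"]
    unfolding z by (simp_all add: antisym)
next
  fix u v :: "nat \<Rightarrow> 'k" assume uv: "u \<in> G" "v \<in> G"
  have "\<Phi> (pmass p (u - v)) \<le> \<Phi> (\<lambda>i. 2 powr p * (pmass p u i + pmass p v i))"
    by (rule \<Phi>_mono) (rule pmass_diff)
  also have "\<dots> \<le> ennreal (2 powr p) * (\<Phi> (pmass p u) + \<Phi> (pmass p v))"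
    by (subst \<Phi>_scale) (auto intro: mult_left_mono \<Phi>_add)
  also have "\<dots> < \<infinity>" using uv by (simp add: in_G_iff ennreal_mult_less_top)
  finally show "u - v \<in> G" by (simp add: in_G_iff)
next
  fix v :: "nat \<Rightarrow> 'k" and c assume v: "v \<in> G"
  have "\<Phi> (pmass p (seq_scale c v)) \<le> ennreal (norm c powr p) * \<Phi> (pmass p v)"
    unfolding pmass_scale[abs_def] by (rule \<Phi>_scale_le) simp
  also have "\<dots> < \<infinity>" using v by (simp add: in_G_iff ennreal_mult_less_top)
  finally show "seq_scale c v \<in> G" by (simp add: in_G_iff)
next
  fix u v :: "nat \<Rightarrow> 'k" assume v: "v \<in> G" and le: "\<And>i. norm (u i) \<le> norm (v i)"
  have "\<Phi> (pmass p u) \<le> \<Phi> (pmass p v)"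
    by (rule \<Phi>_mono) (use le p_pos in \<open>auto simp: pmass_def intro: powr_mono2\<close>)
  then show "u \<in> G \<and> gnorm u \<le> gnorm v"
    by (intro gnorm_leI order_trans[OF _ \<Phi>_le_norm(1)[OF v]] \<Phi>_le_norm(2)[OF v])
next
  fix v :: "nat \<Rightarrow> 'k" and i assume v: "v \<in> G"
  have "ennreal (pmass p v i) \<le> ennreal (gnorm v powr p)"
    by (rule order_trans[OF \<Phi>_coord \<Phi>_le_norm(1)[OF v]])
  then have "norm (v i) powr p \<le> gnorm v powr p" by (simp add: pmass_def)
  then show "norm (v i) \<le> gnorm v"
    using powr_less_mono2[OF p_pos, of "gnorm v" "norm (v i)"] \<Phi>_le_norm(2)[OF v] by linarith
next
  fix v :: "nat \<Rightarrow> 'k" and K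
  assume bound: "\<And>A. finite A \<Longrightarrow> (\<lambda>i. if i \<in> A then v i else 0) \<in> G \<and>
      gnorm (\<lambda>i. if i \<in> A then v i else 0) \<le> K"
  have K: "0 \<le> K" using bound[of "{}"] \<Phi>_le_norm(2) by force
  have "\<Phi> (pmass p v) \<le> ennreal (K powr p)"
  proof (rule \<Phi>_least)
    fix A :: "nat set" assume A: "finite A"
    let ?v = "\<lambda>i. if i \<in> A then v i else 0"
    have "ennreal (S (pmass p v) A) = ennreal (S (pmass p ?v) A)"
      by (intro arg_cong[where f = ennreal] ranked_sum_cong) (simp add: pmass_def)
    also have "\<dots> \<le> \<Phi> (pmass p ?v)" using A by (rule \<Phi>_upper)
    also have "\<dots> \<le> ennreal (gnorm ?v powr p)" using bound[OF A] \<Phi>_le_norm(1) by blast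
    also have "\<dots> \<le> ennreal (K powr p)"
      using bound[OF A] \<Phi>_le_norm(2)[of ?v] p_pos by (intro ennreal_leI powr_mono2) auto
    finally show "ennreal (S (pmass p v) A) \<le> ennreal (K powr p)" .
  qed
  then show "v \<in> G \<and> gnorm v \<le> K" using K by (rule gnorm_leI)
qed

section \<open>Domination in terms of \<Phi>\<close>

lemma dominates_massI:
  fixes x y :: "nat \<Rightarrow> nat \<Rightarrow> 'k::real_normed_field"
  assumes x: "range x \<subseteq> G" "disjoint_seqs x" and y: "range y \<subseteq> G" "disjoint_seqs y"
    and "0 \<le> K"
    and le: "\<And>\<beta> n. (\<And>j. 0 \<le> \<beta> j) \<Longrightarrow> \<Phi> (\<lambda>i. \<Sum>j<n. \<beta> j * pmass p (y j) i) \<le>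
        ennreal K * \<Phi> (\<lambda>i. \<Sum>j<n. \<beta> j * pmass p (x j) i)"
  shows "dominates G gnorm x y"
proof (rule dominatesI[OF x y])
  fix b :: "nat \<Rightarrow> 'k" and n
  have "\<Phi> (pmass p (partial_sum b y n)) \<le> ennreal K * \<Phi> (pmass p (partial_sum b x n))"
    using le[of "\<lambda>j. norm (b j) powr p" n]
    unfolding pmass_partial_sum[OF x(2), abs_def] pmass_partial_sum[OF y(2), abs_def] by simp
  also have "\<dots> = ennreal ((K powr (1 / p) * gnorm (partial_sum b x n)) powr p)"
    unfolding gnorm_powr[OF partial_sum_in[OF x(1)], of b n, symmetric]
    using \<open>0 \<le> K\<close> p_pos \<Phi>_le_norm(2)[OF partial_sum_in[OF x(1)], of b n]
    by (simp add: powr_mult powr_powr ennreal_mult)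
  finally have "\<Phi> (pmass p (partial_sum b y n)) \<le> ennreal ((K powr (1 / p) * gnorm (partial_sum b x n)) powr p)" .
  then show "gnorm (partial_sum b y n) \<le> K powr (1 / p) * gnorm (partial_sum b x n)"
    by (rule gnorm_leI[THEN conjunct2])
       (intro mult_nonneg_nonneg \<Phi>_le_norm(2) partial_sum_in x powr_ge_zero)
qed

text \<open>Nonnegative coefficients \<beta> are the p-th powers of the scalars
  \<open>of_real (\<beta> j powr (1 / p))\<close>, so the bound for scalar combinations becomes one
  for \<Phi>.\<close>

lemma dominates_massD:
  fixes x y :: "nat \<Rightarrow> nat \<Rightarrow> 'k::real_normed_field"
  assumes x: "range x \<subseteq> G" "disjoint_seqs x" and y: "range y \<subseteq> G" "disjoint_seqs y"
    and dom: "dominates G gnorm x y"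
  obtains K where "0 \<le> K" "\<And>\<beta> n. (\<And>j. 0 \<le> \<beta> j) \<Longrightarrow> \<Phi> (\<lambda>i. \<Sum>j<n. \<beta> j * pmass p (y j) i) \<le>
        ennreal K * \<Phi> (\<lambda>i. \<Sum>j<n. \<beta> j * pmass p (x j) i)"
proof -
  obtain C where C: "\<And>b n. gnorm (partial_sum b y n) \<le> C * gnorm (partial_sum b x n)"
    using dominatesD[OF x(1) dom] by blast
  let ?C = "max C 0"
  show thesis
  proof (rule that[of "?C powr p"])
    fix \<beta> :: "nat \<Rightarrow> real" and n assume \<beta>: "\<And>j. 0 \<le> \<beta> j"
    define b :: "nat \<Rightarrow> 'k" where "b j = of_real (\<beta> j powr (1 / p))" for j
    have b: "norm (b j) powr p = \<beta> j" for j
      using \<beta> p_pos by (simp add: b_def powr_powr)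
    let ?x = "partial_sum b x n" and ?y = "partial_sum b y n"
    have "\<Phi> (\<lambda>i. \<Sum>j<n. \<beta> j * pmass p (y j) i) = \<Phi> (pmass p ?y)"
      unfolding pmass_partial_sum[OF y(2), abs_def] b ..
    also have "\<dots> = ennreal (gnorm ?y powr p)"
      by (rule gnorm_powr[OF partial_sum_in[OF y(1)], symmetric])
    also have "gnorm ?y powr p \<le> (?C * gnorm ?x) powr p"
    proof (rule powr_mono2)
      have "C * gnorm ?x \<le> ?C * gnorm ?x"
        by (intro mult_right_mono \<Phi>_le_norm(2) partial_sum_in x) auto
      then show "gnorm ?y \<le> ?C * gnorm ?x" using C[of b n] by linarith
    qed (use p_pos \<Phi>_le_norm(2)[OF partial_sum_in[OF y(1)]] in auto)
    also have "ennreal \<dots> = ennreal (?C powr p) * ennreal (gnorm ?x powr p)"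
      by (subst powr_mult) (auto simp: ennreal_mult)
    also have "ennreal (gnorm ?x powr p) = \<Phi> (\<lambda>i. \<Sum>j<n. \<beta> j * pmass p (x j) i)"
      unfolding gnorm_powr[OF partial_sum_in[OF x(1)]] pmass_partial_sum[OF x(2), abs_def] b ..
    finally show "\<Phi> (\<lambda>i. \<Sum>j<n. \<beta> j * pmass p (y j) i) \<le>
        ennreal (?C powr p) * \<Phi> (\<lambda>i. \<Sum>j<n. \<beta> j * pmass p (x j) i)"
      by (simp add: ennreal_leI)
  qed simp
qed

end

section \<open>Groups\<close>

definition shift :: "nat \<Rightarrow> (nat \<Rightarrow> real) \<Rightarrow> nat \<Rightarrow> real" where
  "shift a u i = (if a \<le> i then u (i - a) else 0)"

definition trunc :: "nat \<Rightarrow> (nat \<Rightarrow> real) \<Rightarrow> nat \<Rightarrow> real" where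
  "trunc l u i = (if i < l then u i else 0)"

definition tail :: "nat \<Rightarrow> (nat \<Rightarrow> real) \<Rightarrow> nat \<Rightarrow> real" where
  "tail l u i = (if l \<le> i then u i else 0)"

section \<open>Moving blocks, and the construction of one group\<close>

context garling_weight
begin

text \<open>Block \<open>j\<close> fits into an interval of length \<open>l j\<close> in both
  arrangements, in the same order, so translating each interval is strictly increasing on the
  support. The hypotheses are symmetric in \<open>a\<close> and \<open>b\<close>: gaps between
  blocks do not affect \<Phi>.\<close>

lemma \<Phi>_relocate:
  fixes u :: "nat \<Rightarrow> nat \<Rightarrow> real"
  assumes nonneg: "\<And>j i. 0 \<le> u j i" and supp: "\<And>j i. l j \<le> i \<Longrightarrow> u j i = 0"
    and a: "\<And>j k. j < k \<Longrightarrow> a j + l j \<le> a k" and b: "\<And>j k. j < k \<Longrightarrow> b j + l j \<le> b k"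
  shows "\<Phi> (\<lambda>i. \<Sum>j<n. shift (a j) (u j) i) \<le> \<Phi> (\<lambda>i. \<Sum>j<n. shift (b j) (u j) i)"
proof -
  let ?U = "\<lambda>i. \<Sum>j<n. shift (a j) (u j) i"
  \<comment> \<open>Meaningful only inside the blocks, which suffices because \<psi> is tested on
    the support alone.\<close>
  define blk where "blk i = (THE j. a j \<le> i \<and> i < a j + l j)" for i
  define \<psi> where "\<psi> i = i - a (blk i) + b (blk i)" for i
  have blk: "blk i = j" if "a j \<le> i" "i < a j + l j" for i j
    unfolding blk_def
  proof (rule the_equality)
    fix k assume "a k \<le> i \<and> i < a k + l k"
    then show "k = j" using that a[of j k] a[of k j] by (cases k j rule: linorder_cases) auto
  qed (use that in simp)
  have shift_pos: "a j \<le> i \<and> i < a j + l j" if "shift (a j) (u j) i \<noteq> 0" for i j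
    using that supp[of j "i - a j"] by (cases "l j \<le> i - a j") (auto simp: shift_def split: if_splits)
  have ex: "blk i < n" "a (blk i) \<le> i" "i < a (blk i) + l (blk i)" "?U i = u (blk i) (i - a (blk i))"
    if U: "?U i \<noteq> 0" for i
  proof -
    obtain j where j: "j < n" "shift (a j) (u j) i \<noteq> 0"
      using U by (meson lessThan_iff sum.not_neutral_contains_not_neutral)
    then have "blk i = j" using blk shift_pos by blast
    then show "blk i < n" "a (blk i) \<le> i" "i < a (blk i) + l (blk i)"
      using j shift_pos[of j i] by auto
    have "shift (a k) (u k) i = 0" if "k \<noteq> j" for k
      using that blk[of k i] shift_pos[of k i] \<open>blk i = j\<close> by blast
    then have "?U i = (\<Sum>k\<in>{j}. shift (a k) (u k) i)"
      using j(1) by (intro sum.mono_neutral_right) auto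
    then show "?U i = u (blk i) (i - a (blk i))"
      using \<open>blk i = j\<close> \<open>a (blk i) \<le> i\<close> by (simp add: shift_def)
  qed
  show ?thesis
  proof (rule \<Phi>_spread[where \<psi> = \<psi>])
    show "0 \<le> ?U i" for i by (intro sum_nonneg) (simp add: shift_def nonneg)
    show "strict_mono_on {i. ?U i \<noteq> 0} \<psi>"
    proof (rule strict_mono_onI)
      fix i k assume "i \<in> {i. ?U i \<noteq> 0}" "k \<in> {i. ?U i \<noteq> 0}" and less: "i < k"
      then have i: "a (blk i) \<le> i" "i < a (blk i) + l (blk i)"
        and k: "a (blk k) \<le> k" "k < a (blk k) + l (blk k)"
        using ex by auto
      show "\<psi> i < \<psi> k"
      proof (cases "blk i" "blk k" rule: linorder_cases)
        case less
        then show ?thesis using b[OF less] i k by (simp add: \<psi>_def)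
      next
        case equal
        then show ?thesis using i k \<open>i < k\<close> by (simp add: \<psi>_def)
      next
        case greater
        then show ?thesis using a[OF greater] i k \<open>i < k\<close> by simp
      qed
    qed
    fix i assume "?U i \<noteq> 0"
    note i = ex[OF this]
    have "?U i = shift (b (blk i)) (u (blk i)) (\<psi> i)" using i by (simp add: shift_def \<psi>_def)
    also have "\<dots> \<le> (\<Sum>j<n. shift (b j) (u j) (\<psi> i))"
      using i(1) by (intro member_le_sum) (auto simp: shift_def nonneg)
    finally show "?U i \<le> (\<Sum>j<n. shift (b j) (u j) (\<psi> i))" .
  qed
qed

lemma \<Phi>_shift_le:
  assumes "\<And>i. 0 \<le> u i"
  shows "\<Phi> (shift a u) \<le> \<Phi> u"
proof (rule \<Phi>_spread[where \<psi> = "\<lambda>i. i - a"])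
  show "strict_mono_on {i. shift a u i \<noteq> 0} (\<lambda>i. i - a)"
    by (rule strict_mono_onI) (auto simp: shift_def split: if_splits)
qed (auto simp: shift_def assms)

text \<open>
  The new level is put in front of the old ones. Selecting many of its coordinates pushes the
  remaining ones to weights that are too small to matter, while selecting few of them contributes
  little; so a single copy cannot profit from two levels. Several successive copies can, each
  one contributing a different level.
\<close>

lemma levels_exist:
  assumes \<eta>: "0 < \<eta>" and K: "0 < (K :: real)"
  shows "\<exists>n M g. (\<forall>i. 0 \<le> g i) \<and> (\<forall>i\<ge>n. g i = 0) \<and> \<Phi> g \<le> ennreal (\<eta> * (1 + real q / K)) \<and>
    (\<forall>a. (\<forall>i. a i + n \<le> a (Suc i)) \<longrightarrow>
      (\<exists>A. finite A \<and> card A = M \<and> A \<subseteq> {..<a q} \<and>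
        real q * \<eta> / 2 \<le> S (\<lambda>i. \<Sum>j<q. shift (a j) g i) A))"
proof (induction q)
  case 0
  show ?case
    by (rule exI[of _ 0], rule exI[of _ 0], rule exI[of _ "\<lambda>_. 0"])
       (auto simp: ranked_sum_def intro!: exI[of _ "{}"])
next
  case (Suc q)
  then obtain n M g where g: "\<And>i. 0 \<le> g i" "\<And>i. n \<le> i \<Longrightarrow> g i = 0"
    and \<Phi>g: "\<Phi> g \<le> ennreal (\<eta> * (1 + real q / K))"
    and lower: "\<And>a. (\<And>i. a i + n \<le> a (Suc i)) \<Longrightarrow>
      \<exists>A. finite A \<and> card A = M \<and> A \<subseteq> {..<a q} \<and>
        real q * \<eta> / 2 \<le> S (\<lambda>i. \<Sum>j<q. shift (a j) g i) A"
    by blast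
  define m where "m = (\<Sum>i<n. g i)"
  have m: "0 \<le> m" unfolding m_def by (intro sum_nonneg g)
  \<comment> \<open>After \<theta> selected coordinates of the new level, the whole old group, of
    mass \<open>m\<close>, weighs at most \<open>\<eta> / K\<close>.\<close>
  obtain \<theta> where \<theta>: "m * w \<theta> \<le> \<eta> / K"
  proof -
    have "(\<lambda>i. m * w i) \<longlonglongrightarrow> m * 0" by (intro tendsto_intros w_lim)
    then have "\<forall>\<^sub>F i in sequentially. m * w i < \<eta> / K"
      using \<eta> K by (intro order_tendstoD(2)) auto
    then show thesis using that by (auto simp: eventually_sequentially intro: less_imp_le)
  qed
  obtain l where l: "max 1 (max (2 * W M) (K * W \<theta>)) \<le> W l" using W_unbounded by blast
  define v where "v = \<eta> / W l"
  have W_l: "1 \<le> W l" "2 * W M \<le> W l" "K * W \<theta> \<le> W l" using l by auto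
  have v: "0 \<le> v" "v * W l = \<eta>" using W_l \<eta> by (auto simp: v_def)
  define g' where "g' i = (if i < l then v else g (i - l))" for i
  have g': "0 \<le> g' i" for i using g v by (simp add: g'_def)
  have g'_zero: "g' i = 0" if "l + n \<le> i" for i using that g(2) by (simp add: g'_def)
  have "\<Phi> g' \<le> ennreal (\<eta> * (1 + real (Suc q) / K))"
  proof (rule \<Phi>_least, rule ennreal_leI)
    fix A :: "nat set" assume A: "finite A"
    define A1 where "A1 = A \<inter> {..<l}"
    define A2 where "A2 = {i. i + l \<in> A}"
    have fin: "finite A1" "finite A2"
      using A finite_vimageI[of A "\<lambda>i. i + l"] by (auto simp: A1_def A2_def vimage_def inj_def)
    have split: "A = A1 \<union> (\<lambda>i. i + l) ` A2"
    proof (rule set_eqI)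
      fix i show "i \<in> A \<longleftrightarrow> i \<in> A1 \<union> (\<lambda>i. i + l) ` A2"
        by (cases "i < l") (auto simp: A1_def A2_def intro!: image_eqI[of _ _ "i - l"])
    qed
    let ?B = "(\<lambda>i. i + l) ` A2"
    let ?T = "\<Sum>j\<in>?B. g' j * w (card A1 + card (?B \<inter> {..<j}))"
    have S_eq: "S g' A = S g' A1 + ?T"
      unfolding split using fin by (intro ranked_sum_Un) (auto simp: A1_def)
    have S1: "S g' A1 \<le> v * W c" if "card A1 \<le> c" for c
      using that fin v g'
      by (intro S_le_const) (auto simp: A1_def g'_def intro: order_trans[OF card_mono])
    have card_l: "card A1 \<le> l"
      using card_mono[of "{..<l}" A1] by (auto simp: A1_def)
    have sum_le_m: "(\<Sum>j\<in>?B. g' j) \<le> m"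
    proof -
      have "(\<Sum>j\<in>?B. g' j) = (\<Sum>i\<in>A2. g i)"
        by (subst sum.reindex) (auto simp: g'_def)
      also have "\<dots> = (\<Sum>i\<in>A2 \<inter> {..<n}. g i)"
        using fin g(2) by (intro sum.mono_neutral_right) (auto simp: not_less[symmetric])
      also have "\<dots> \<le> m" unfolding m_def using g by (intro sum_mono2) auto
      finally show ?thesis .
    qed
    \<comment> \<open>Either many points of the new level are selected and the old part is
      negligible, or few are and the new level is negligible; each case loses only one further
      \<open>\<eta> / K\<close>.\<close>
    show "S g' A \<le> \<eta> * (1 + real (Suc q) / K)"
    proof (cases "\<theta> \<le> card A1")
      case True
      have "?T \<le> (\<Sum>j\<in>?B. g' j * w \<theta>)"
        using True by (intro sum_mono mult_left_mono g' w_antimono) auto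
      also have "\<dots> \<le> m * w \<theta>"
        unfolding sum_distrib_right[symmetric] by (intro mult_right_mono sum_le_m w_nonneg)
      finally have "S g' A \<le> \<eta> + \<eta> / K" using S_eq S1[OF card_l] v \<theta> by linarith
      also have "\<dots> \<le> \<eta> * (1 + real (Suc q) / K)" using \<eta> K by (simp add: field_simps)
      finally show ?thesis .
    next
      case False
      have "?T \<le> S g' ?B"
        unfolding ranked_sum_def by (intro sum_mono mult_left_mono g' w_antimono) auto
      also have "\<dots> = S (\<lambda>i. g' (i + l)) A2"
        by (rule ranked_sum_image) (auto simp: strict_mono_on_def)
      also have "\<dots> = S g A2" by (rule ranked_sum_cong) (simp add: g'_def)
      also have "\<dots> \<le> \<eta> * (1 + real q / K)" 
        using \<eta> K fin by (intro S_le_\<Phi>D[OF \<Phi>g]) auto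
      finally have T: "?T \<le> \<eta> * (1 + real q / K)" .
      have "v * W \<theta> \<le> \<eta> / K"
        using W_l(1,3) \<eta> K by (simp add: v_def field_simps)
      then have "S g' A \<le> \<eta> / K + \<eta> * (1 + real q / K)"
        using S_eq T S1[of \<theta>] False by linarith
      also have "\<dots> = \<eta> * (1 + real (Suc q) / K)" using K by (simp add: field_simps)
      finally show ?thesis .
    qed
  qed
  moreover have "\<exists>B. finite B \<and> card B = M + l \<and> B \<subseteq> {..<a (Suc q)} \<and>
      real (Suc q) * \<eta> / 2 \<le> S (\<lambda>i. \<Sum>j<Suc q. shift (a j) g' i) B"
    if a: "\<And>i. a i + (l + n) \<le> a (Suc i)" for a
  proof -
    \<comment> \<open>The first \<open>q\<close> copies contribute their old parts, which now start
      \<open>l\<close> later. Copy \<open>q\<close> keeps its start, so that \<open>A\<close> ends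
      before the new level of that copy begins.\<close>
    define a' where "a' i = (if i < q then a i + l else a i)" for i
    have "a' i + n \<le> a' (Suc i)" for i
      using a[of i] by (auto simp: a'_def)
    then have "\<exists>A. finite A \<and> card A = M \<and> A \<subseteq> {..<a' q} \<and>
        real q * \<eta> / 2 \<le> S (\<lambda>i. \<Sum>j<q. shift (a' j) g i) A"
      by (rule lower)
    then obtain A where A: "finite A" "card A = M" "A \<subseteq> {..<a q}"
      "real q * \<eta> / 2 \<le> S (\<lambda>i. \<Sum>j<q. shift (a' j) g i) A"
      by (auto simp: a'_def)
    let ?I = "{a q..<a q + l}"
    let ?U = "\<lambda>i. \<Sum>j<Suc q. shift (a j) g' i"
    have "S (\<lambda>i. \<Sum>j<q. shift (a' j) g i) A \<le> S ?U A"
    proof (rule S_mono)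
      fix i
      have "(\<Sum>j<q. shift (a' j) g i) \<le> (\<Sum>j<q. shift (a j) g' i)"
        using v g by (intro sum_mono) (auto simp: shift_def g'_def a'_def)
      moreover have "0 \<le> shift (a q) g' i" using g' by (simp add: shift_def)
      ultimately show "(\<Sum>j<q. shift (a' j) g i) \<le> ?U i" by simp
    qed
    moreover have "\<eta> / 2 \<le> (\<Sum>i\<in>?I. ?U i * w (card A + card (?I \<inter> {..<i})))"
    proof -
      \<comment> \<open>The weights at ranks \<open>M\<close> to \<open>M + l - 1\<close> still add
        up to at least half of \<open>W l\<close>, because \<open>2 * W M \<le> W l\<close>.\<close>
      have "\<eta> / 2 \<le> v * (\<Sum>k<l. w (M + k))"
      proof -
        have "W (M + l) = W M + (\<Sum>k<l. w (M + k))"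
          unfolding W_def by (induction l) auto
        then have "W l / 2 \<le> (\<Sum>k<l. w (M + k))"
          using W_mono[of l "M + l"] W_l by simp
        then have "v * (W l / 2) \<le> v * (\<Sum>k<l. w (M + k))" using v by (intro mult_left_mono)
        then show ?thesis using v by simp
      qed
      also have "(\<Sum>k<l. w (M + k)) = (\<Sum>i\<in>?I. w (card A + card (?I \<inter> {..<i})))"
        using sum_rank[of ?I "\<lambda>k. w (M + k)"] A by simp
      also have "v * \<dots> \<le> (\<Sum>i\<in>?I. ?U i * w (card A + card (?I \<inter> {..<i})))"
        unfolding sum_distrib_left
      proof (intro sum_mono mult_right_mono w_nonneg)
        fix i assume i: "i \<in> ?I"
        have "0 \<le> (\<Sum>j<q. shift (a j) g' i)" using g' by (intro sum_nonneg) (simp add: shift_def)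
        moreover have "shift (a q) g' i = v" using i by (auto simp: shift_def g'_def)
        ultimately show "v \<le> ?U i" by simp
      qed
      finally show ?thesis .
    qed
    moreover have "S ?U (A \<union> ?I) = S ?U A + (\<Sum>i\<in>?I. ?U i * w (card A + card (?I \<inter> {..<i})))"
      using A by (intro ranked_sum_Un) auto
    ultimately have "real (Suc q) * \<eta> / 2 \<le> S ?U (A \<union> ?I)"
      using A(4) by (simp add: field_simps)
    moreover have "card (A \<union> ?I) = M + l"
      using A by (subst card_Un_disjoint) auto
    moreover have "A \<union> ?I \<subseteq> {..<a (Suc q)}" using A(3) a[of q] by fastforce
    ultimately show ?thesis using A(1) by (intro exI[of _ "A \<union> ?I"]) auto
  qed
  ultimately show ?case
    using g' g'_zero
    by - (rule exI[of _ "l + n"], rule exI[of _ "M + l"], rule exI[of _ g'], blast)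
qed

text \<open>Stack \<open>N\<close> levels of size \<open>\<delta> / 2\<close> with
  \<open>K = N\<close>: the losses at most double the \<Phi> of one copy, while \<open>N\<close>
  copies reach \<open>N * \<delta> / 4\<close>. This is at least \<open>R * W N\<close> once
  \<open>N\<close> is chosen with \<open>W N\<close> small compared to \<open>N\<close>.\<close>

lemma group_exists:
  assumes "0 < \<delta>" "0 < R"
  shows "\<exists>N n g. 0 < N \<and> (\<forall>i. 0 \<le> g i) \<and> (\<forall>i\<ge>n. g i = 0) \<and> \<Phi> g \<le> ennreal \<delta> \<and>
    (\<forall>a. (\<forall>i. a i + n \<le> a (Suc i)) \<longrightarrow>
      ennreal (R * W N) \<le> \<Phi> (\<lambda>i. \<Sum>j<N. shift (a j) g i))"
proof -
  obtain N where N: "0 < N" "W N \<le> \<delta> / (4 * R) * real N"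
    using W_sublinear[of "\<delta> / (4 * R)"] assms by auto
  have RW: "R * W N \<le> real N * (\<delta> / 2) / 2"
    using N(2) assms by (simp add: field_simps)
  obtain n M g where g: "\<And>i. 0 \<le> g i" "\<And>i. n \<le> i \<Longrightarrow> g i = 0" "\<Phi> g \<le> ennreal \<delta>"
    and levels: "\<And>a. (\<And>i. a i + n \<le> a (Suc i)) \<Longrightarrow> \<exists>A. finite A \<and> card A = M \<and> A \<subseteq> {..<a N} \<and>
        real N * (\<delta> / 2) / 2 \<le> S (\<lambda>i. \<Sum>j<N. shift (a j) g i) A"
    using levels_exist[of "\<delta> / 2" "real N" N] assms N(1) by auto
  have lower: "ennreal (R * W N) \<le> \<Phi> (\<lambda>i. \<Sum>j<N. shift (a j) g i)"
    if gap: "\<And>i. a i + n \<le> a (Suc i)" for a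
  proof -
    obtain A where "finite A" "real N * (\<delta> / 2) / 2 \<le> S (\<lambda>i. \<Sum>j<N. shift (a j) g i) A"
      using levels[of a] gap by blast
    then show ?thesis
      using RW by (intro order_trans[OF ennreal_leI \<Phi>_upper[of A]]) simp_all
  qed
  show ?thesis
    by (rule exI[of _ N], rule exI[of _ n], rule exI[of _ g]) (use N(1) g lower in auto)
qed

end

section \<open>Block sequences of a shape\<close>

definition start :: "(nat \<Rightarrow> nat) \<Rightarrow> nat \<Rightarrow> nat" where
  "start l j = (\<Sum>i<j. l i)"

definition block :: "(nat \<Rightarrow> real) \<Rightarrow> (nat \<Rightarrow> nat) \<Rightarrow> nat \<Rightarrow> nat \<Rightarrow> real" where
  "block c l j = shift (start l j) (trunc (l j) c)"

text \<open>The p-th root makes \<open>pmass\<close> of each vector equal to the block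
  itself.\<close>

definition block_seq :: "real \<Rightarrow> (nat \<Rightarrow> real) \<Rightarrow> (nat \<Rightarrow> nat) \<Rightarrow> nat \<Rightarrow> nat \<Rightarrow> 'k::real_normed_field" where
  "block_seq p c l j i = of_real (block c l j i powr (1 / p))"

lemma start_le:
  assumes "j < k"
  shows "start l j + l j \<le> start l k"
proof -
  have "start l j + l j = (\<Sum>i<Suc j. l i)" by (simp add: start_def)
  also have "\<dots> \<le> start l k" unfolding start_def using assms by (intro sum_mono2) auto
  finally show ?thesis .
qed

lemma block_nonzeroD:
  assumes "block c l j i \<noteq> 0"
  shows "start l j \<le> i" "i < start l j + l j"
  using assms by (auto simp: block_def shift_def trunc_def split: if_splits)

lemma block_disjoint: "block c l j i \<noteq> 0 \<Longrightarrow> block c l k i \<noteq> 0 \<Longrightarrow> j = k"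
  using block_nonzeroD[of c l j i] block_nonzeroD[of c l k i] start_le[of j k l] start_le[of k j l]
  by (cases j k rule: linorder_cases) auto

text \<open>Passing to a subsequence lengthens the truncations of the shape; the summable bounds
  \<tau> on its tails control the cost.\<close>

locale garling_shape = garling +
  fixes c :: "nat \<Rightarrow> real" and l :: "nat \<Rightarrow> nat" and \<tau> :: "nat \<Rightarrow> real"
  assumes c_nonneg: "0 \<le> c i" and c_0: "c 0 = 1"
    and l_pos: "0 < l j" and l_mono: "mono l"
    and \<tau>_nonneg: "0 \<le> \<tau> j" and \<tau>_summable: "summable \<tau>"
    and tail_le: "\<Phi> (tail (l j) c) \<le> ennreal (\<tau> j)"
begin

lemma block_nonneg: "0 \<le> block c l j i"
  by (simp add: block_def shift_def trunc_def c_nonneg)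

lemma block_start: "block c l j (start l j) = 1"
  by (simp add: block_def shift_def trunc_def c_0 l_pos)

lemma pmass_block_seq: "pmass p (block_seq p c l j) = block c l j"
  using p_pos block_nonneg by (auto simp: pmass_def block_seq_def powr_powr)

lemma disjoint_block_seq: "disjoint_seqs (block_seq p c l :: nat \<Rightarrow> nat \<Rightarrow> 'k::real_normed_field)"
proof -
  have "block c l j i \<noteq> 0" if "block_seq p c l j i \<noteq> (0 :: 'k)" for j i
    using that by (auto simp: block_seq_def)
  moreover have "block_seq p c l j (start l j) = (1 :: 'k)" for j
    by (simp add: block_seq_def block_start)
  then have "block_seq p c l j \<noteq> (0 :: nat \<Rightarrow> 'k)" for j
    by (metis zero_fun_apply zero_neq_one)
  ultimately show ?thesis
    unfolding disjoint_seqs_def using block_disjoint by blast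
qed

lemma block_seq_in: "range (block_seq p c l :: nat \<Rightarrow> nat \<Rightarrow> 'k::real_normed_field) \<subseteq> G"
proof -
  have "{i. block c l j i \<noteq> 0} \<subseteq> {..<start l j + l j}" for j
    using block_nonzeroD by blast
  then have "\<Phi> (block c l j) < \<infinity>" for j
    by (intro \<Phi>_finite_support block_nonneg) (auto intro: finite_subset)
  then show ?thesis by (auto simp: in_G_iff pmass_block_seq)
qed

text \<open>Block \<open>\<phi> j\<close> contains a translate of block \<open>j\<close>, since
  \<open>j \<le> \<phi> j\<close> and lengths are non-decreasing; relocating these translates costs
  nothing.\<close>

lemma \<Phi>_block_comp_ge:
  assumes \<beta>: "\<And>j. 0 \<le> \<beta> j" and \<phi>: "strict_mono \<phi>"
  shows "\<Phi> (\<lambda>i. \<Sum>j<n. \<beta> j * block c l j i) \<le> \<Phi> (\<lambda>i. \<Sum>j<n. \<beta> j * block c l (\<phi> j) i)"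
proof -
  define u where "u j i = \<beta> j * trunc (l j) c i" for j i
  have le: "l j \<le> l (\<phi> j)" for j
    using l_mono strict_mono_imp_increasing[OF \<phi>] by (auto simp: mono_def)
  have "\<Phi> (\<lambda>i. \<Sum>j<n. \<beta> j * block c l j i) = \<Phi> (\<lambda>i. \<Sum>j<n. shift (start l j) (u j) i)"
    by (intro arg_cong[where f = \<Phi>] ext sum.cong) (auto simp: block_def shift_def u_def)
  also have "\<dots> \<le> \<Phi> (\<lambda>i. \<Sum>j<n. shift (start l (\<phi> j)) (u j) i)"
  proof (rule \<Phi>_relocate)
    fix j k :: nat assume "j < k"
    show "start l j + l j \<le> start l k" using \<open>j < k\<close> by (rule start_le)
    show "start l (\<phi> j) + l j \<le> start l (\<phi> k)"
      using start_le[OF strict_monoD[OF \<phi> \<open>j < k\<close>], of l] le[of j] by linarith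
  qed (auto simp: u_def trunc_def \<beta> c_nonneg)
  also have "\<dots> \<le> \<Phi> (\<lambda>i. \<Sum>j<n. \<beta> j * block c l (\<phi> j) i)"
  proof (rule \<Phi>_mono, rule sum_mono)
    fix i j
    have "i < l (\<phi> j)" if "i < l j" for i using that le[of j] by simp
    then show "shift (start l (\<phi> j)) (u j) i \<le> \<beta> j * block c l (\<phi> j) i"
      by (auto simp: shift_def u_def block_def trunc_def \<beta> c_nonneg)
  qed
  finally show ?thesis .
qed

text \<open>Split block \<open>\<phi> j\<close> at length \<open>l j\<close>. The initial parts
  relocate onto the original blocks, and the remainders cost at most
  \<open>\<beta> j * \<tau> j\<close>, where \<open>\<beta> j\<close> is itself bounded by
  \<open>?F\<close>.\<close>

lemma \<Phi>_block_comp_le: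
  assumes \<beta>: "\<And>j. 0 \<le> \<beta> j" and \<phi>: "strict_mono \<phi>"
  shows "\<Phi> (\<lambda>i. \<Sum>j<n. \<beta> j * block c l (\<phi> j) i) \<le>
    ennreal (1 + suminf \<tau>) * \<Phi> (\<lambda>i. \<Sum>j<n. \<beta> j * block c l j i)" (is "_ \<le> _ * ?F")
proof -
  define u where "u j i = \<beta> j * trunc (l j) c i" for j i
  define v where "v j i = \<beta> j * tail (l j) c i" for j i
  have le: "l j \<le> l (\<phi> j)" for j
    using l_mono strict_mono_imp_increasing[OF \<phi>] by (auto simp: mono_def)
  have "\<Phi> (\<lambda>i. \<Sum>j<n. \<beta> j * block c l (\<phi> j) i) \<le>
      \<Phi> (\<lambda>i. (\<Sum>j<n. shift (start l (\<phi> j)) (u j) i) + (\<Sum>j<n. shift (start l (\<phi> j)) (v j) i))"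
    unfolding sum.distrib[symmetric]
    by (intro \<Phi>_mono sum_mono)
       (auto simp: block_def shift_def u_def v_def trunc_def tail_def \<beta> c_nonneg)
  also have "\<dots> \<le> \<Phi> (\<lambda>i. \<Sum>j<n. shift (start l (\<phi> j)) (u j) i) +
      (\<Sum>j<n. \<Phi> (shift (start l (\<phi> j)) (v j)))"
    by (intro order_trans[OF \<Phi>_add] add_left_mono \<Phi>_sum)
  also have "\<Phi> (\<lambda>i. \<Sum>j<n. shift (start l (\<phi> j)) (u j) i) \<le> \<Phi> (\<lambda>i. \<Sum>j<n. shift (start l j) (u j) i)"
  proof (rule \<Phi>_relocate)
    fix j k :: nat assume "j < k"
    show "start l j + l j \<le> start l k" using \<open>j < k\<close> by (rule start_le)
    show "start l (\<phi> j) + l j \<le> start l (\<phi> k)"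
      using start_le[OF strict_monoD[OF \<phi> \<open>j < k\<close>], of l] le[of j] by linarith
  qed (auto simp: u_def trunc_def \<beta> c_nonneg)
  also have "\<Phi> (\<lambda>i. \<Sum>j<n. shift (start l j) (u j) i) = ?F"
    by (intro arg_cong[where f = \<Phi>] ext sum.cong) (auto simp: block_def shift_def u_def)
  also have "(\<Sum>j<n. \<Phi> (shift (start l (\<phi> j)) (v j))) \<le> (\<Sum>j<n. ennreal (\<tau> j) * ?F)"
  proof (rule sum_mono)
    fix j assume j: "j \<in> {..<n}"
    have "\<Phi> (shift (start l (\<phi> j)) (v j)) \<le> \<Phi> (v j)"
      by (rule \<Phi>_shift_le) (simp add: v_def tail_def \<beta> c_nonneg)
    also have "\<dots> \<le> ennreal (\<beta> j) * \<Phi> (tail (l j) c)"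
      unfolding v_def by (rule \<Phi>_scale_le) (rule \<beta>)
    also have "\<dots> \<le> ?F * ennreal (\<tau> j)"
    proof (rule mult_mono)
      \<comment> \<open>Each block begins with the value 1, so some coordinate of the combination is
        at least \<open>\<beta> j\<close>.\<close>
      have "\<beta> j * block c l j (start l j) \<le> (\<Sum>k<n. \<beta> k * block c l k (start l j))"
        using j by (intro member_le_sum) (auto simp: \<beta> block_nonneg)
      then have "ennreal (\<beta> j) \<le> ennreal (\<Sum>k<n. \<beta> k * block c l k (start l j))"
        by (simp add: block_start ennreal_leI)
      also have "\<dots> \<le> ?F" by (rule \<Phi>_coord)
      finally show "ennreal (\<beta> j) \<le> ?F" .
    qed (auto simp: tail_le)
    finally show "\<Phi> (shift (start l (\<phi> j)) (v j)) \<le> ennreal (\<tau> j) * ?F" by (simp add: mult.commute)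
  qed
  also have "\<dots> = ennreal (\<Sum>j<n. \<tau> j) * ?F"
    by (simp add: sum_distrib_right[symmetric] sum_ennreal \<tau>_nonneg)
  also have "\<dots> \<le> ennreal (suminf \<tau>) * ?F"
    using \<tau>_nonneg \<tau>_summable by (intro mult_right_mono ennreal_leI sum_le_suminf) auto
  finally have "\<Phi> (\<lambda>i. \<Sum>j<n. \<beta> j * block c l (\<phi> j) i) \<le> ?F + ennreal (suminf \<tau>) * ?F"
    by (simp add: add_left_mono add_right_mono)
  also have "\<dots> = ennreal (1 + suminf \<tau>) * ?F"
    using suminf_nonneg[OF \<tau>_summable] \<tau>_nonneg by (simp add: distrib_right)
  finally show ?thesis .
qed

lemma subsymmetric_block_seq:
  "subsymmetric G gnorm (block_seq p c l :: nat \<Rightarrow> nat \<Rightarrow> 'k::real_normed_field)"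
  unfolding subsymmetric_def equivalent_seqs_def
proof (intro conjI allI impI)
  let ?x = "block_seq p c l :: nat \<Rightarrow> nat \<Rightarrow> 'k"
  note x = block_seq_in[where 'k = 'k] disjoint_block_seq[where 'k = 'k]
  show "basic_sequence G gnorm ?x" "unconditional G gnorm ?x"
    using basic_sequence_disjoint[OF x] unconditional_disjoint[OF x] by blast+
  fix \<phi> :: "nat \<Rightarrow> nat" assume \<phi>: "strict_mono \<phi>"
  have x\<phi>: "range (?x \<circ> \<phi>) \<subseteq> G" "disjoint_seqs (?x \<circ> \<phi>)"
    using x \<phi> by (auto intro!: disjoint_seqs_comp strict_mono_imp_inj_on)
  show "dominates G gnorm (?x \<circ> \<phi>) ?x"
    using \<Phi>_block_comp_ge[OF _ \<phi>]
    by (intro dominates_massI[OF x\<phi> x, of 1]) (auto simp: pmass_block_seq)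
  show "dominates G gnorm ?x (?x \<circ> \<phi>)"
    using \<Phi>_block_comp_le[OF _ \<phi>] suminf_nonneg[OF \<tau>_summable] \<tau>_nonneg
    by (intro dominates_massI[OF x x\<phi>, of "1 + suminf \<tau>"]) (auto simp: pmass_block_seq)
qed

end

section \<open>Shapes built from groups\<close>

lemma sum_quarter_powers: "(\<Sum>t=r..<r + d. (1 / 4 :: real) ^ t) \<le> 4 / 3 * (1 / 4) ^ r"
proof -
  have "(\<Sum>t=r..<r + d. x ^ t) * (1 - x) = x ^ r - x ^ (r + d)" for x :: real
  proof (induction d)
    case (Suc d)
    then show ?case by (simp add: distrib_right) (simp add: algebra_simps)
  qed simp
  from this[of "1 / 4"] have "(\<Sum>t=r..<r + d. (1 / 4 :: real) ^ t) * (3 / 4) \<le> (1 / 4) ^ r"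
    by simp
  then show ?thesis by linarith
qed

text \<open>If only finitely many indices occurred, the rationals they enumerate would have a least
  element, contradicting density.\<close>

lemma infinite_rats_between:
  fixes x y :: real
  assumes "x < y"
  shows "infinite {n. x < of_rat (nat_to_rat_surj n) \<and> of_rat (nat_to_rat_surj n) < y}"
    (is "infinite ?R")
proof
  assume fin: "finite ?R"
  let ?V = "(\<lambda>n. of_rat (nat_to_rat_surj n) :: real) ` ?R"
  have dense: "\<exists>v\<in>?V. v < z" if z: "x < z" "z \<le> y" for z
  proof -
    obtain q where q: "x < of_rat q" "of_rat q < z" using of_rat_dense[OF z(1)] by blast
    obtain n where "q = nat_to_rat_surj n" using surj_nat_to_rat_surj by (meson surjE)
    then show ?thesis using q z(2) by auto
  qed
  have "?V \<noteq> {}" using dense[OF assms order_refl] by blast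
  then have "Min ?V \<in> ?V" using fin by (intro Min_in) auto
  then obtain v where "v \<in> ?V" "v < Min ?V" using dense[of "Min ?V"] by fastforce
  moreover have "Min ?V \<le> v" using fin \<open>v \<in> ?V\<close> by (intro Min_le finite_imageI)
  ultimately show False by linarith
qed

context garling_weight
begin

text \<open>Injectivity makes the sum the indicator of \<open>n\<close> distinct points.\<close>

lemma \<Phi>_indicator_le:
  assumes "inj_on b {..<n}"
  shows "\<Phi> (\<lambda>i. \<Sum>q<n. if i = b q then 1 else 0) \<le> ennreal (W n)"
proof -
  let ?u = "\<lambda>i. \<Sum>q<n. if i = b q then 1 else 0 :: real"
  have supp: "{i. ?u i \<noteq> 0} \<subseteq> b ` {..<n}"
  proof (rule subsetI, rule ccontr)
    fix i assume i: "i \<in> {i. ?u i \<noteq> 0}" "i \<notin> b ` {..<n}"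
    then have "?u i = 0" by (intro sum.neutral) auto
    then show False using i(1) by simp
  qed
  have "?u i \<le> 1" for i
  proof -
    have "?u i = real (card {q\<in>{..<n}. i = b q})" by (simp add: sum.If_cases Int_def)
    moreover have "card {q\<in>{..<n}. i = b q} \<le> Suc 0"
      using assms by (subst card_le_Suc0_iff_eq) (auto simp: inj_on_def)
    ultimately show ?thesis by simp
  qed
  moreover have "card {i. ?u i \<noteq> 0} \<le> n"
    using card_mono[OF _ supp] card_image_le[of "{..<n}" b] by fastforce
  ultimately have "\<Phi> ?u \<le> ennreal (1 * W n)"
    using finite_subset[OF supp] by (intro \<Phi>_le_card) (auto intro: sum_nonneg)
  then show ?thesis by simp
qed

end

text \<open>Group \<open>r\<close> occupies the coordinates from \<open>L r\<close> to
  \<open>L (Suc r) - 1\<close> of the shape; coordinate 0 holds the leading 1, hence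
  \<open>L 0 = 1\<close>. \<open>m r\<close> is the mass of everything before group
  \<open>r\<close>, and \<open>N r\<close> is the number of copies that detects the group:
  \<open>copies\<close> beats what the earlier part can contribute by a factor growing with
  \<open>r\<close>, and \<open>\<Phi>_g_later\<close> keeps later groups negligible.\<close>

locale garling_groups = garling +
  fixes L :: "nat \<Rightarrow> nat" and N :: "nat \<Rightarrow> nat" and g :: "nat \<Rightarrow> nat \<Rightarrow> real" and m :: "nat \<Rightarrow> real"
  assumes L_0: "L 0 = 1" and L_mono: "strict_mono L" and N_pos: "0 < N r"
    and g_nonneg: "0 \<le> g r i" and g_zero: "L (Suc r) \<le> L r + i \<Longrightarrow> g r i = 0"
    and \<Phi>_g: "\<Phi> (g r) \<le> ennreal ((1 / 4) ^ r)"
    and \<Phi>_g_later: "s < r \<Longrightarrow> \<Phi> (g r) \<le> ennreal (1 / N s * (1 / 4) ^ r)"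
    and m_0: "m 0 = 1" and m_Suc: "m (Suc r) = m r + (\<Sum>i<L (Suc r) - L r. g r i)"
    and copies: "(\<And>i. a i + L (Suc r) \<le> a (Suc i) + L r) \<Longrightarrow>
      ennreal (real (Suc r) * (2 + m r) * W (N r)) \<le> \<Phi> (\<lambda>i. \<Sum>j<N r. shift (a j) (g r) i)"
begin

lemma L_gt: "r < L r"
proof (induction r)
  case (Suc r)
  then show ?case using strict_monoD[OF L_mono, of r "Suc r"] by simp
qed (simp add: L_0)

lemma L_le: "r \<le> s \<Longrightarrow> L r \<le> L s"
  using L_mono by (simp add: strict_mono_less_eq)

lemma m_pos: "0 < m r"
  by (induction r) (auto simp: m_0 m_Suc intro!: add_pos_nonneg sum_nonneg g_nonneg)

lemma group_nonneg: "0 \<le> shift (L r) (g r) i"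
  by (simp add: shift_def g_nonneg)

lemma group_nonzeroD:
  assumes "shift (L r) (g r) i \<noteq> 0"
  shows "L r \<le> i" "i < L (Suc r)"
proof -
  show "L r \<le> i" using assms by (auto simp: shift_def split: if_splits)
  show "i < L (Suc r)"
  proof (rule ccontr)
    assume "\<not> i < L (Suc r)"
    then show False using assms g_zero[of r "i - L r"] by (auto simp: shift_def split: if_splits)
  qed
qed

lemma group_unique:
  assumes "L r \<le> i" "i < L (Suc r)" "s \<noteq> r"
  shows "shift (L s) (g s) i = 0"
proof (rule ccontr)
  assume "shift (L s) (g s) i \<noteq> 0"
  then have "L s \<le> i" "i < L (Suc s)" using group_nonzeroD by blast+
  then show False
    using assms L_le[of "Suc r" s] L_le[of "Suc s" r] by (cases s r rule: linorder_cases) auto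
qed

text \<open>Restricting the sum to \<open>r < i\<close> makes it finite and omits nothing, because
  \<open>r < L r\<close> puts all other groups beyond \<open>i\<close>.\<close>

definition shape :: "nat set \<Rightarrow> nat \<Rightarrow> real" where
  "shape A i = (if i = 0 then 1 else 0) + (\<Sum>r\<in>A \<inter> {..<i}. shift (L r) (g r) i)"

lemma shape_nonneg: "0 \<le> shape A i"
  by (simp add: shape_def sum_nonneg group_nonneg)

lemma shape_mono: "A \<subseteq> B \<Longrightarrow> shape A i \<le> shape B i"
  unfolding shape_def by (intro add_left_mono sum_mono2) (auto simp: group_nonneg)

lemma shape_in_group:
  assumes "L r \<le> i" "i < L (Suc r)"
  shows "shape A i = (if r \<in> A then g r (i - L r) else 0)"
proof -
  have i: "r < i" using assms L_gt[of r] by simp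
  have "(\<Sum>s\<in>A \<inter> {..<i}. shift (L s) (g s) i) =
      (\<Sum>s\<in>A \<inter> {r}. shift (L s) (g s) i)"
    using i group_unique[OF assms] by (intro sum.mono_neutral_cong) auto
  then show ?thesis using i assms by (auto simp: shape_def shift_def)
qed

text \<open>Groups before \<open>r\<close> end before coordinate \<open>L r\<close>, and only groups
  with index below \<open>i\<close> reach \<open>i\<close>. The bound is a finite sum, as finite
  sublinearity of \<Phi> requires.\<close>

lemma shape_tail:
  assumes i: "L r \<le> i" "i < r + d"
  shows "shape A i \<le> (\<Sum>s=r..<r + d. shift (L s) (g s) i)"
proof -
  have "shift (L s) (g s) i = 0" if "s < i" "s \<notin> {r..<r + d}" for s
  proof (rule ccontr)
    assume "shift (L s) (g s) i \<noteq> 0"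
    then show False
      using that i L_le[of "Suc s" r] group_nonzeroD[of s i] by (cases "s < r") auto
  qed
  then have "(\<Sum>s\<in>A \<inter> {..<i}. shift (L s) (g s) i) =
      (\<Sum>s\<in>A \<inter> {..<i} \<inter> {r..<r + d}. shift (L s) (g s) i)"
    by (intro sum.mono_neutral_right) auto
  also have "\<dots> \<le> (\<Sum>s=r..<r + d. shift (L s) (g s) i)"
    by (intro sum_mono2) (auto simp: group_nonneg)
  finally show ?thesis using L_gt[of r] i by (simp add: shape_def)
qed

text \<open>A finite set meets finitely many groups, and their bounds form a geometric series. The
  factor \<open>e\<close> is 1 for subsymmetry and \<open>1 / N r\<close> for discarding the groups
  after \<open>r\<close>.\<close>

lemma \<Phi>_shape_tail:
  assumes "0 \<le> e" and le: "\<And>s. r \<le> s \<Longrightarrow> \<Phi> (g s) \<le> ennreal (e * (1 / 4) ^ s)"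
  shows "\<Phi> (tail (L r) (shape A)) \<le> ennreal (e * (4 / 3 * (1 / 4) ^ r))"
proof (rule \<Phi>_least)
  fix B :: "nat set" assume B: "finite B"
  then obtain d where d: "B \<subseteq> {..<d}" using finite_nat_iff_bounded by blast
  let ?u = "\<lambda>i. \<Sum>s=r..<r + d. shift (L s) (g s) i"
  have "S (tail (L r) (shape A)) B \<le> S ?u B"
    using d shape_tail[of r _ d A]
    by (intro S_mono) (auto simp: tail_def subset_iff trans_less_add2 intro: sum_nonneg group_nonneg)
  then have "ennreal (S (tail (L r) (shape A)) B) \<le> ennreal (S ?u B)" by (rule ennreal_leI)
  also have "\<dots> \<le> (\<Sum>s=r..<r + d. \<Phi> (shift (L s) (g s)))"
    by (rule order_trans[OF \<Phi>_upper[OF B] \<Phi>_sum])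
  also have "\<dots> \<le> (\<Sum>s=r..<r + d. ennreal (e * (1 / 4) ^ s))"
  proof (rule sum_mono)
    fix s assume "s \<in> {r..<r + d}"
    then show "\<Phi> (shift (L s) (g s)) \<le> ennreal (e * (1 / 4) ^ s)"
      using \<Phi>_shift_le[of "g s" "L s"] g_nonneg le[of s] by (auto intro: order_trans)
  qed
  also have "\<dots> = ennreal (e * (\<Sum>s=r..<r + d. (1 / 4) ^ s))"
    using \<open>0 \<le> e\<close> by (simp add: sum_distrib_left)
  also have "\<dots> \<le> ennreal (e * (4 / 3 * (1 / 4) ^ r))"
    using \<open>0 \<le> e\<close> sum_quarter_powers by (intro ennreal_leI mult_left_mono)
  finally show "ennreal (S (tail (L r) (shape A)) B) \<le> ennreal (e * (4 / 3 * (1 / 4) ^ r))" .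
qed

text \<open>With length \<open>L (Suc j)\<close>, block \<open>j\<close> contains the selected
  groups up to index \<open>j\<close> completely; the tail bound is
  \<open>4 / 3 * (1 / 4) ^ Suc j\<close>.\<close>

sublocale shape: garling_shape w p "shape A" "\<lambda>j. L (Suc j)" "\<lambda>j. 1 / 3 * (1 / 4) ^ j" for A
proof
  show "0 \<le> shape A i" for i by (rule shape_nonneg)
  show "shape A 0 = 1" by (simp add: shape_def)
  show "0 < L (Suc j)" for j using L_gt[of "Suc j"] by simp
  show "mono (\<lambda>j. L (Suc j))" using L_le by (simp add: mono_def)
  show "summable (\<lambda>j. 1 / 3 * (1 / 4 :: real) ^ j)" by (intro summable_mult summable_geometric) simp
  show "\<Phi> (tail (L (Suc j)) (shape A)) \<le> ennreal (1 / 3 * (1 / 4) ^ j)" for j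
    using \<Phi>_shape_tail[of 1 "Suc j" A] \<Phi>_g by simp
qed simp

lemma sum_shape_le: "(\<Sum>i<L r. shape A i) \<le> m r"
proof (induction r)
  case 0
  then show ?case by (simp add: L_0 m_0 shape_def)
next
  case (Suc r)
  have "(\<Sum>i<L (Suc r). shape A i) = (\<Sum>i<L r. shape A i) + (\<Sum>i=L r..<L (Suc r). shape A i)"
    unfolding lessThan_atLeast0 using L_le[of r "Suc r"]
    by (intro sum.atLeastLessThan_concat[symmetric]) auto
  also have "(\<Sum>i=L r..<L (Suc r). shape A i) \<le> (\<Sum>i=L r..<L (Suc r). g r (i - L r))"
    by (intro sum_mono) (auto simp: shape_in_group g_nonneg)
  also have "\<dots> = (\<Sum>i<L (Suc r) - L r. g r i)"
    by (rule sum.reindex_bij_witness[of _ "\<lambda>i. i + L r" "\<lambda>i. i - L r"]) auto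
  finally show ?case using Suc by (simp add: m_Suc)
qed

section \<open>Consecutive blocks with and without group \<open>r\<close>\<close>

definition shape_seq :: "nat set \<Rightarrow> nat \<Rightarrow> nat \<Rightarrow> 'k::real_normed_field" where
  "shape_seq A = block_seq p (shape A) (\<lambda>j. L (Suc j))"

abbreviation "Y A \<equiv> block (shape A) (\<lambda>j. L (Suc j))"
abbreviation "s \<equiv> start (\<lambda>j. L (Suc j))"

text \<open>Group \<open>r\<close> lies completely in every block from \<open>r\<close> on, which is
  why the test vector starts at block \<open>r\<close>; its copies are far enough apart for
  \<open>copies\<close>.\<close>

lemma Y_copies_ge:
  assumes "r \<in> B"
  shows "ennreal (real (Suc r) * (2 + m r) * W (N r)) \<le> \<Phi> (\<lambda>i. \<Sum>q<N r. Y B (r + q) i)"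
proof -
  define a where "a q = s (r + q) + L r" for q
  have "ennreal (real (Suc r) * (2 + m r) * W (N r)) \<le> \<Phi> (\<lambda>i. \<Sum>q<N r. shift (a q) (g r) i)"
  proof (rule copies)
    fix q
    show "a q + L (Suc r) \<le> a (Suc q) + L r"
      using L_le[of "Suc r" "Suc (r + q)"] by (simp add: a_def start_def)
  qed
  also have "\<dots> \<le> \<Phi> (\<lambda>i. \<Sum>q<N r. Y B (r + q) i)"
  proof (rule \<Phi>_mono, rule sum_mono)
    fix i q
    show "shift (a q) (g r) i \<le> Y B (r + q) i"
    proof (cases "a q \<le> i \<and> i < s (r + q) + L (Suc r)")
      case True
      then have "shape B (i - s (r + q)) = shift (a q) (g r) i"
        using shape_in_group[of r "i - s (r + q)" B] assms
        by (auto simp: a_def shift_def)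
      moreover have "i - s (r + q) < L (Suc (r + q))"
        using True L_le[of "Suc r" "Suc (r + q)"] unfolding a_def by arith
      ultimately show ?thesis using True by (simp add: block_def a_def shift_def trunc_def)
    next
      case False
      then have "shift (a q) (g r) i = 0"
        using g_zero[of r "i - a q"] by (auto simp: shift_def a_def)
      then show ?thesis using shape.block_nonneg by simp
    qed
  qed
  finally show ?thesis .
qed

text \<open>Without group \<open>r\<close>, a block consists of point masses before
  \<open>L r\<close> and of a tail that begins only with group \<open>Suc r\<close>.\<close>

lemma Y_le_early_late:
  assumes "r \<notin> A"
  shows "Y A j i \<le> (\<Sum>t<L r. shape A t * (if i = s j + t then 1 else 0)) +
    shift (s j) (tail (L (Suc r)) (shape A)) i" (is "_ \<le> ?E + ?T")
proof -
  have E: "0 \<le> ?E" by (intro sum_nonneg) (auto simp: shape_nonneg)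
  have T: "0 \<le> ?T" by (auto simp: shift_def tail_def shape_nonneg)
  consider "i < s j" | "s j \<le> i" "i - s j < L r" | "s j \<le> i" "L r \<le> i - s j" "i - s j < L (Suc r)"
    | "s j \<le> i" "L (Suc r) \<le> i - s j" by linarith
  then show ?thesis
  proof cases
    case 1
    then show ?thesis using E T by (simp add: block_def shift_def)
  next
    case 2
    have "Y A j i \<le> shape A (i - s j) * (if i = s j + (i - s j) then 1 else 0)"
      using 2 by (simp add: block_def shift_def trunc_def shape_nonneg)
    also have "\<dots> \<le> ?E" using 2 by (intro member_le_sum) (auto simp: shape_nonneg)
    finally show ?thesis using T by simp
  next
    case 3
    then have "shape A (i - s j) = 0" using assms by (simp add: shape_in_group)
    then have "Y A j i = 0" by (simp add: block_def shift_def trunc_def)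
    then show ?thesis using E T by simp
  next
    case 4
    then have "Y A j i \<le> ?T" by (simp add: block_def shift_def trunc_def tail_def shape_nonneg)
    then show ?thesis using E by simp
  qed
qed

text \<open>For each early coordinate \<open>t\<close> the copies form \<open>N r\<close> points of
  height \<open>shape A t\<close>, in all at most \<open>m r * W (N r)\<close>. Each late tail
  carries a factor \<open>1 / N r\<close>, so all of them together cost at most
  \<open>W (N r)\<close>.\<close>

lemma Y_copies_le:
  assumes "r \<notin> A"
  shows "\<Phi> (\<lambda>i. \<Sum>q<N r. Y A (r + q) i) \<le> ennreal ((1 + m r) * W (N r))"
proof -
  let ?e = "\<lambda>t i. \<Sum>q<N r. if i = s (r + q) + t then 1 else 0 :: real"
  let ?T = "\<lambda>q. shift (s (r + q)) (tail (L (Suc r)) (shape A))"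
  have swap: "(\<Sum>q<N r. \<Sum>t<L r. shape A t * (if i = s (r + q) + t then 1 else 0)) =
      (\<Sum>t<L r. shape A t * ?e t i)" for i
    by (subst sum.swap) (simp add: sum_distrib_left)
  have "\<Phi> (\<lambda>i. \<Sum>q<N r. Y A (r + q) i) \<le>
      \<Phi> (\<lambda>i. (\<Sum>t<L r. shape A t * ?e t i) + (\<Sum>q<N r. ?T q i))"
    unfolding swap[symmetric] sum.distrib[symmetric]
    by (intro \<Phi>_mono sum_mono Y_le_early_late assms)
  also have "\<dots> \<le> (\<Sum>t<L r. \<Phi> (\<lambda>i. shape A t * ?e t i)) + (\<Sum>q<N r. \<Phi> (?T q))"
    by (rule order_trans[OF \<Phi>_add add_mono[OF \<Phi>_sum \<Phi>_sum]])
  also have "(\<Sum>t<L r. \<Phi> (\<lambda>i. shape A t * ?e t i)) \<le> ennreal (m r * W (N r))"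
  proof -
    have "\<Phi> (\<lambda>i. shape A t * ?e t i) \<le> ennreal (shape A t * W (N r))" for t
    proof -
      have "inj (\<lambda>q. s (r + q) + t)"
      proof (rule strict_mono_imp_inj_on, rule strict_monoI)
        fix x y :: nat assume "x < y"
        then show "s (r + x) + t < s (r + y) + t"
          using start_le[of "r + x" "r + y" "\<lambda>j. L (Suc j)"] L_gt[of "Suc (r + x)"] by simp
      qed
      then have "\<Phi> (?e t) \<le> ennreal (W (N r))" by (intro \<Phi>_indicator_le) (rule inj_on_subset, auto)
      then show ?thesis
        using order_trans[OF \<Phi>_scale_le mult_left_mono] by (simp add: shape_nonneg ennreal_mult W_nonneg)
    qed
    then have "(\<Sum>t<L r. \<Phi> (\<lambda>i. shape A t * ?e t i)) \<le> (\<Sum>t<L r. ennreal (shape A t * W (N r)))"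
      by (intro sum_mono)
    also have "\<dots> = ennreal ((\<Sum>t<L r. shape A t) * W (N r))"
      by (simp add: sum_distrib_right shape_nonneg W_nonneg)
    also have "\<dots> \<le> ennreal (m r * W (N r))"
      by (intro ennreal_leI mult_right_mono sum_shape_le W_nonneg)
    finally show ?thesis .
  qed
  also have "(\<Sum>q<N r. \<Phi> (?T q)) \<le> ennreal (W (N r))"
  proof -
    have "\<Phi> (?T q) \<le> ennreal (1 / real (N r) * (1 / 3 * (1 / 4) ^ r))" for q
    proof -
      have "\<Phi> (?T q) \<le> \<Phi> (tail (L (Suc r)) (shape A))"
        by (intro \<Phi>_shift_le) (simp add: tail_def shape_nonneg)
      also have "\<dots> \<le> ennreal (1 / real (N r) * (4 / 3 * (1 / 4) ^ Suc r))"
        by (intro \<Phi>_shape_tail \<Phi>_g_later) auto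
      finally show ?thesis by simp
    qed
    then have "(\<Sum>q<N r. \<Phi> (?T q)) \<le> (\<Sum>q<N r. ennreal (1 / real (N r) * (1 / 3 * (1 / 4) ^ r)))"
      by (intro sum_mono)
    also have "\<dots> = ennreal (1 / 3 * (1 / 4) ^ r)"
      using N_pos[of r] by (subst sum_ennreal) auto
    also have "\<dots> \<le> ennreal (W (N r))"
    proof (rule ennreal_leI)
      have "(1 / 4 :: real) ^ r \<le> 1" by (intro power_le_one) auto
      then show "1 / 3 * (1 / 4) ^ r \<le> W (N r)" using W_ge_1[OF N_pos[of r]] by linarith
    qed
    finally show ?thesis .
  qed
  finally have "\<Phi> (\<lambda>i. \<Sum>q<N r. Y A (r + q) i) \<le> ennreal (m r * W (N r)) + ennreal (W (N r))"
    by (simp add: add_left_mono add_right_mono)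
  also have "\<dots> = ennreal ((1 + m r) * W (N r))"
    using m_pos[of r] W_nonneg by (simp add: algebra_simps flip: ennreal_plus)
  finally show ?thesis .
qed

section \<open>Domination and inclusion of index sets\<close>

lemma subsymmetric_shape_seq: "subsymmetric G gnorm (shape_seq A)"
  unfolding shape_seq_def by (rule shape.subsymmetric_block_seq)

lemma dominates_shape_seq:
  assumes "A \<subseteq> B"
  shows "dominates G gnorm (shape_seq B :: nat \<Rightarrow> nat \<Rightarrow> 'k::real_normed_field) (shape_seq A)"
  unfolding shape_seq_def
proof (rule dominates_massI[OF shape.block_seq_in shape.disjoint_block_seq
      shape.block_seq_in shape.disjoint_block_seq, of 1])
  fix \<beta> :: "nat \<Rightarrow> real" and n assume \<beta>: "\<And>j. 0 \<le> \<beta> j"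
  have "Y A j i \<le> Y B j i" for j i
    using shape_mono[OF assms] by (simp add: block_def shift_def trunc_def)
  then show "\<Phi> (\<lambda>i. \<Sum>j<n. \<beta> j * pmass p (block_seq p (shape A) (\<lambda>j. L (Suc j)) j :: nat \<Rightarrow> 'k) i) \<le>
      ennreal 1 * \<Phi> (\<lambda>i. \<Sum>j<n. \<beta> j * pmass p (block_seq p (shape B) (\<lambda>j. L (Suc j)) j :: nat \<Rightarrow> 'k) i)"
    using \<beta> by (auto simp: shape.pmass_block_seq intro!: \<Phi>_mono sum_mono mult_left_mono)
qed simp

text \<open>For \<open>r\<close> in \<open>B - A\<close>, the sum of the blocks \<open>r\<close> to
  \<open>r + N r - 1\<close> is large for \<open>B\<close> and small for \<open>A\<close>, with a
  quotient of at least \<open>Suc r\<close>; infinitely many such \<open>r\<close> exclude every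
  constant.\<close>

lemma not_dominates_shape_seq:
  assumes "infinite (B - A)"
  shows "\<not> dominates G gnorm (shape_seq A :: nat \<Rightarrow> nat \<Rightarrow> 'k::real_normed_field) (shape_seq B)"
proof
  assume "dominates G gnorm (shape_seq A :: nat \<Rightarrow> nat \<Rightarrow> 'k) (shape_seq B)"
  then obtain K where K: "0 \<le> K" and le: "\<And>\<beta> n. (\<And>j. 0 \<le> \<beta> j) \<Longrightarrow>
      \<Phi> (\<lambda>i. \<Sum>j<n. \<beta> j * Y B j i) \<le> ennreal K * \<Phi> (\<lambda>i. \<Sum>j<n. \<beta> j * Y A j i)"
    unfolding shape_seq_def
    by (rule dominates_massD[OF shape.block_seq_in shape.disjoint_block_seq
      shape.block_seq_in shape.disjoint_block_seq]) (simp add: shape.pmass_block_seq)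
  obtain k :: nat where k: "K \<le> k" using real_arch_simple by blast
  obtain r where r: "k \<le> r" "r \<in> B" "r \<notin> A"
    using assms by (metis DiffD1 DiffD2 infinite_nat_iff_unbounded_le)
  \<comment> \<open>The combinations in the domination inequality start at index 0, so the blocks
    before \<open>r\<close> get coefficient 0.\<close>
  define \<beta> where "\<beta> j = (if r \<le> j then 1 else 0 :: real)" for j
  have sum_eq: "(\<Sum>j<r + N r. \<beta> j * u j) = (\<Sum>q<N r. u (r + q))" for u :: "nat \<Rightarrow> real"
  proof -
    have "(\<Sum>j<r + N r. \<beta> j * u j) = (\<Sum>j=r..<r + N r. u j)"
      by (intro sum.mono_neutral_cong_right) (auto simp: \<beta>_def)
    also have "\<dots> = (\<Sum>q<N r. u (r + q))"
      by (rule sum.reindex_bij_witness[of _ "\<lambda>q. r + q" "\<lambda>j. j - r"]) auto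
    finally show ?thesis .
  qed
  have "ennreal (real (Suc r) * (2 + m r) * W (N r)) \<le>
      ennreal K * ennreal ((1 + m r) * W (N r))"
  proof -
    have "0 \<le> \<beta> j" for j by (simp add: \<beta>_def)
    from le[of \<beta> "r + N r", OF this]
    have "\<Phi> (\<lambda>i. \<Sum>q<N r. Y B (r + q) i) \<le> ennreal K * \<Phi> (\<lambda>i. \<Sum>q<N r. Y A (r + q) i)"
      unfolding sum_eq .
    also have "\<dots> \<le> ennreal K * ennreal ((1 + m r) * W (N r))"
      by (intro mult_left_mono Y_copies_le r) simp
    finally show ?thesis using Y_copies_ge[OF r(2)] order_trans by blast
  qed
  then have "real (Suc r) * (2 + m r) * W (N r) \<le> K * ((1 + m r) * W (N r))"
    using K m_pos[of r] W_nonneg[of "N r"] by (simp flip: ennreal_mult')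
  moreover have "K * ((1 + m r) * W (N r)) < real (Suc r) * ((2 + m r) * W (N r))"
    using K k r(1) m_pos[of r] W_ge_1[OF N_pos[of r]]
    by (intro mult_strict_mono' mult_strict_right_mono mult_nonneg_nonneg) auto
  ultimately show False by (simp add: mult.assoc)
qed

section \<open>Families indexed by the real numbers\<close>

lemma family_eqpoll:
  fixes D :: "real \<Rightarrow> nat set"
  assumes "\<And>x z. x < z \<Longrightarrow> infinite (D z - D x)"
  shows "range (\<lambda>x. shape_seq (D x) :: nat \<Rightarrow> nat \<Rightarrow> 'k::real_normed_field) \<approx> (UNIV :: real set)"
proof (rule inj_on_image_eqpoll_self, rule injI)
  \<comment> \<open>Equal sequences dominate each other, so distinct parameters give distinct
    sequences.\<close>
  fix x z assume "(shape_seq (D x) :: nat \<Rightarrow> nat \<Rightarrow> 'k) = shape_seq (D z)"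
  then show "x = z"
    using not_dominates_shape_seq[OF assms, of x z] not_dominates_shape_seq[OF assms, of z x] dominates_refl
    by (metis linorder_neqE_linordered_idom)
qed

lemma ordered_family:
  "\<exists>F :: (nat \<Rightarrow> nat \<Rightarrow> 'k::real_normed_field) set.
     F \<approx> (UNIV :: real set) \<and> (\<forall>x\<in>F. subsymmetric G gnorm x) \<and>
     (\<forall>x\<in>F. \<forall>y\<in>F. x \<noteq> y \<longrightarrow> \<not> equivalent_seqs G gnorm x y) \<and>
     (\<forall>x\<in>F. \<forall>y\<in>F. dominates G gnorm x y \<or> dominates G gnorm y x)"
proof -
  \<comment> \<open>Cuts of the rationals: a chain of sets in which any two differ by infinitely
    many indices.\<close>
  define D where "D x = {n. of_rat (nat_to_rat_surj n) < x}" for x :: real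
  have inf: "infinite (D z - D x)" if "x < z" for x z
    using infinite_rats_between[OF that] by (rule contrapos_nn) (auto simp: D_def elim: rev_finite_subset)
  have neq: "\<not> equivalent_seqs G gnorm (shape_seq (D x) :: nat \<Rightarrow> nat \<Rightarrow> 'k) (shape_seq (D z))" if "x \<noteq> z" for x z
    using that not_dominates_shape_seq[OF inf, of x z] not_dominates_shape_seq[OF inf, of z x]
    by (cases x z rule: linorder_cases) (auto simp: equivalent_seqs_def)
  have dom: "dominates G gnorm (shape_seq (D z) :: nat \<Rightarrow> nat \<Rightarrow> 'k) (shape_seq (D x))" if "x \<le> z" for x z
    using that by (intro dominates_shape_seq) (auto simp: D_def)
  show ?thesis
  proof (intro exI[of _ "range (\<lambda>x. shape_seq (D x))"] conjI)
    show "range (\<lambda>x. shape_seq (D x) :: nat \<Rightarrow> nat \<Rightarrow> 'k) \<approx> (UNIV :: real set)"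
      using inf by (rule family_eqpoll)
    show "\<forall>x\<in>range (\<lambda>x. shape_seq (D x) :: nat \<Rightarrow> nat \<Rightarrow> 'k). subsymmetric G gnorm x"
      by (simp add: subsymmetric_shape_seq)
    show "\<forall>x\<in>range (\<lambda>x. shape_seq (D x) :: nat \<Rightarrow> nat \<Rightarrow> 'k). \<forall>y\<in>range (\<lambda>x. shape_seq (D x)).
        x \<noteq> y \<longrightarrow> \<not> equivalent_seqs G gnorm x y"
    proof (intro ballI impI)
      fix x y :: "nat \<Rightarrow> nat \<Rightarrow> 'k"
      assume "x \<in> range (\<lambda>x. shape_seq (D x))" "y \<in> range (\<lambda>x. shape_seq (D x))" "x \<noteq> y"
      then obtain a b where "x = shape_seq (D a)" "y = shape_seq (D b)" "a \<noteq> b" by auto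
      then show "\<not> equivalent_seqs G gnorm x y" using neq by simp
    qed
    show "\<forall>x\<in>range (\<lambda>x. shape_seq (D x) :: nat \<Rightarrow> nat \<Rightarrow> 'k). \<forall>y\<in>range (\<lambda>x. shape_seq (D x)).
        dominates G gnorm x y \<or> dominates G gnorm y x"
    proof (intro ballI)
      fix x y :: "nat \<Rightarrow> nat \<Rightarrow> 'k"
      assume "x \<in> range (\<lambda>x. shape_seq (D x))" "y \<in> range (\<lambda>x. shape_seq (D x))"
      then obtain a b where "x = shape_seq (D a)" "y = shape_seq (D b)" by auto
      then show "dominates G gnorm x y \<or> dominates G gnorm y x"
        using dom[of a b] dom[of b a] by (cases "a \<le> b") auto
    qed
  qed
qed

lemma incomparable_family:
  "\<exists>F :: (nat \<Rightarrow> nat \<Rightarrow> 'k::real_normed_field) set.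
     F \<approx> (UNIV :: real set) \<and> (\<forall>x\<in>F. subsymmetric G gnorm x) \<and>
     (\<forall>x\<in>F. \<forall>y\<in>F. x \<noteq> y \<longrightarrow> \<not> dominates G gnorm x y \<and> \<not> dominates G gnorm y x)"
proof -
  \<comment> \<open>Even indices carry the lower cut and odd indices the upper cut, so enlarging
    \<open>x\<close> adds infinitely many even indices and removes infinitely many odd ones.\<close>
  define D where "D x = (\<lambda>n. 2 * n) ` {n. of_rat (nat_to_rat_surj n) < x} \<union>
    (\<lambda>n. 2 * n + 1) ` {n. x < of_rat (nat_to_rat_surj n)}" for x :: real
  have inf: "infinite (D z - D x)" "infinite (D x - D z)" if "x < z" for x z
  proof -
    let ?R = "{n. x < of_rat (nat_to_rat_surj n) \<and> of_rat (nat_to_rat_surj n) < z}"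
    have "infinite ((\<lambda>n. 2 * n) ` ?R)" "infinite ((\<lambda>n. 2 * n + 1) ` ?R)"
      using infinite_rats_between[OF that] by (simp_all add: finite_image_iff inj_on_def)
    moreover have "(\<lambda>n. 2 * n) ` ?R \<subseteq> D z - D x" "(\<lambda>n. 2 * n + 1) ` ?R \<subseteq> D x - D z"
      by (auto simp: D_def) presburger+
    ultimately show "infinite (D z - D x)" "infinite (D x - D z)"
      by (meson finite_subset)+
  qed
  have neq: "\<not> dominates G gnorm (shape_seq (D x) :: nat \<Rightarrow> nat \<Rightarrow> 'k) (shape_seq (D z))" if "x \<noteq> z" for x z
    using that inf[of x z] inf[of z x] by (intro not_dominates_shape_seq) (cases x z rule: linorder_cases, auto)
  show ?thesis
  proof (intro exI[of _ "range (\<lambda>x. shape_seq (D x))"] conjI)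
    show "range (\<lambda>x. shape_seq (D x) :: nat \<Rightarrow> nat \<Rightarrow> 'k) \<approx> (UNIV :: real set)"
      using inf(1) by (rule family_eqpoll)
    show "\<forall>x\<in>range (\<lambda>x. shape_seq (D x) :: nat \<Rightarrow> nat \<Rightarrow> 'k). subsymmetric G gnorm x"
      by (simp add: subsymmetric_shape_seq)
    show "\<forall>x\<in>range (\<lambda>x. shape_seq (D x) :: nat \<Rightarrow> nat \<Rightarrow> 'k). \<forall>y\<in>range (\<lambda>x. shape_seq (D x)).
        x \<noteq> y \<longrightarrow> \<not> dominates G gnorm x y \<and> \<not> dominates G gnorm y x"
    proof (intro ballI impI)
      fix x y :: "nat \<Rightarrow> nat \<Rightarrow> 'k"
      assume "x \<in> range (\<lambda>x. shape_seq (D x))" "y \<in> range (\<lambda>x. shape_seq (D x))" "x \<noteq> y"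
      then obtain a b where "x = shape_seq (D a)" "y = shape_seq (D b)" "a \<noteq> b" by auto
      then show "\<not> dominates G gnorm x y \<and> \<not> dominates G gnorm y x" using neq by simp
    qed
  qed
qed

end

section \<open>Recursive choice of the groups\<close>

context garling
begin

text \<open>\<open>group_exists\<close> supplies group \<open>r\<close> with parameters that depend
  only on earlier groups: their mass determines \<open>R\<close>, and their copy numbers determine
  how small \<delta> must be.\<close>

lemma groups_exist: "\<exists>L N g m. garling_groups w p L N g m"
proof -
  \<comment> \<open>Positivity is put into the premises so that choice yields functions of all real
    \<delta> and \<open>R\<close>.\<close>
  have "\<exists>N n g. 0 < \<delta> \<longrightarrow> 0 < R \<longrightarrow> 0 < N \<and> (\<forall>i. 0 \<le> g i) \<and> (\<forall>i\<ge>n. g i = 0) \<and> \<Phi> g \<le> ennreal \<delta> \<and>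
    (\<forall>a. (\<forall>i. a i + n \<le> a (Suc i)) \<longrightarrow>
      ennreal (R * W N) \<le> \<Phi> (\<lambda>i. \<Sum>j<N. shift (a j) g i))" for \<delta> R
    using group_exists[of \<delta> R] by (cases "0 < \<delta> \<and> 0 < R") auto
  then obtain Nf nf gf where groups: "\<And>\<delta> R. 0 < \<delta> \<Longrightarrow> 0 < R \<Longrightarrow> 0 < Nf \<delta> R \<and> (\<forall>i. 0 \<le> gf \<delta> R i) \<and>
    (\<forall>i\<ge>nf \<delta> R. gf \<delta> R i = 0) \<and> \<Phi> (gf \<delta> R) \<le> ennreal \<delta> \<and>
    (\<forall>a. (\<forall>i. a i + nf \<delta> R \<le> a (Suc i)) \<longrightarrow>
      ennreal (R * W (Nf \<delta> R)) \<le> \<Phi> (\<lambda>i. \<Sum>j<Nf \<delta> R. shift (a j) (gf \<delta> R) i))"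
    by metis
  txt \<open>The last component of the state exceeds all earlier \<open>N q\<close>; dividing by it makes group \<open>r\<close>
    negligible for \<open>N q\<close> copies.\<close>
  define dl where "dl r M = (1 / 4) ^ r / M" for r :: nat and M :: real
  define Rf where "Rf r m = real (Suc r) * (2 + m)" for r :: nat and m :: real
  \<comment> \<open>\<open>Suc\<close> makes \<open>L\<close> strictly increasing even if a group
    has length 0; it adds only a coordinate at which the group vanishes.\<close>
  define st where "st = rec_nat (1 :: nat, 1 :: real, 1 :: real) (\<lambda>r (l, m, M).
    (l + Suc (nf (dl r M) (Rf r m)),
     m + (\<Sum>i<Suc (nf (dl r M) (Rf r m)). gf (dl r M) (Rf r m) i),
     M + real (Nf (dl r M) (Rf r m))))"
  define L where "L r = fst (st r)" for r
  define m where "m r = fst (snd (st r))" for r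
  define M where "M r = snd (snd (st r))" for r
  define n where "n r = nf (dl r (M r)) (Rf r (m r))" for r
  define N where "N r = Nf (dl r (M r)) (Rf r (m r))" for r
  define g where "g r = gf (dl r (M r)) (Rf r (m r))" for r
  have init: "L 0 = 1" "m 0 = 1" "M 0 = 1"
    by (simp_all add: L_def m_def M_def st_def)
  have step: "L (Suc r) = L r + Suc (n r)" "m (Suc r) = m r + (\<Sum>i<Suc (n r). g r i)"
    "M (Suc r) = M r + N r" for r
    unfolding L_def m_def M_def n_def N_def g_def
    by (simp_all add: st_def split_beta)
  have pos: "1 \<le> m r \<and> 1 \<le> M r" for r
  proof (induction r)
    case (Suc r)
    then have "0 < dl r (M r)" "0 < Rf r (m r)" by (simp_all add: dl_def Rf_def)
    then have "0 \<le> g r i" for i using groups by (simp add: g_def)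
    then have "0 \<le> (\<Sum>i<Suc (n r). g r i)" by (intro sum_nonneg) simp
    then show ?case using Suc unfolding step by auto
  qed (simp add: init)
  have "0 < dl r (M r)" "0 < Rf r (m r)" for r
    using pos[of r] by (simp_all add: dl_def Rf_def)
  from groups[OF this] have group: "0 < N r" "\<And>i. 0 \<le> g r i" "\<And>i. n r \<le> i \<Longrightarrow> g r i = 0"
    "\<Phi> (g r) \<le> ennreal (dl r (M r))"
    "\<And>a. (\<And>i. a i + n r \<le> a (Suc i)) \<Longrightarrow>
      ennreal (Rf r (m r) * W (N r)) \<le> \<Phi> (\<lambda>i. \<Sum>j<N r. shift (a j) (g r) i)" for r
    unfolding N_def g_def n_def by blast+
  have N_le: "real (N q) \<le> M r" if "q < r" for q r
    using that
  proof (induction r)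
    case (Suc r)
    then show ?case using pos[of r] unfolding step by (cases "q = r") auto
  qed simp
  have "garling_groups w p L N g m"
  proof
    show "L 0 = 1" "m 0 = 1" by (fact init)+
    show "strict_mono L" by (simp add: strict_mono_Suc_iff step)
    fix r
    show "0 < N r" "\<And>i. 0 \<le> g r i" by (fact group)+
    show "g r i = 0" if "L (Suc r) \<le> L r + i" for i
      using that by (intro group) (simp add: step)
    have "dl r (M r) \<le> (1 / 4) ^ r" using pos[of r] by (simp add: dl_def field_simps)
    then show "\<Phi> (g r) \<le> ennreal ((1 / 4) ^ r)"
      using group(4)[of r] by (meson ennreal_leI order_trans)
    show "\<Phi> (g r) \<le> ennreal (1 / N q * (1 / 4) ^ r)" if "q < r" for q
    proof -
      have "dl r (M r) \<le> 1 / N q * (1 / 4) ^ r"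
        using N_le[OF that] group(1)[of q] pos[of r] by (simp add: dl_def frac_le)
      then show ?thesis using group(4)[of r] by (meson ennreal_leI order_trans)
    qed
    show "m (Suc r) = m r + (\<Sum>i<L (Suc r) - L r. g r i)" by (simp add: step)
    show "ennreal (real (Suc r) * (2 + m r) * W (N r)) \<le> \<Phi> (\<lambda>i. \<Sum>j<N r. shift (a j) (g r) i)"
      if gap: "\<And>i. a i + L (Suc r) \<le> a (Suc i) + L r" for a
    proof -
      have "a i + n r \<le> a (Suc i)" for i using gap[of i] by (simp add: step)
      then show ?thesis using group(5)[of a r] by (simp add: Rf_def)
    qed
  qed
  then show ?thesis by blast
qed

end

theorem theorem3p21:
  fixes p :: real and w :: "nat \<Rightarrow> real"
    and X :: "(nat \<Rightarrow> 'k::{real_normed_field, banach}) set"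
    and N :: "(nat \<Rightarrow> 'k) \<Rightarrow> real"
  assumes "0 < p" and "w \<in> garling_weights"
  defines "X \<equiv> garling_space w p" and "N \<equiv> garling_norm w p"
  shows "(\<exists>F :: (nat \<Rightarrow> nat \<Rightarrow> 'k) set.
            F \<approx> (UNIV :: real set) \<and>
            (\<forall>x\<in>F. subsymmetric X N x) \<and>
            (\<forall>x\<in>F. \<forall>y\<in>F. x \<noteq> y \<longrightarrow> \<not> equivalent_seqs X N x y) \<and>
            (\<forall>x\<in>F. \<forall>y\<in>F. dominates X N x y \<or> dominates X N y x)) \<and>
         (\<exists>F :: (nat \<Rightarrow> nat \<Rightarrow> 'k) set.
            F \<approx> (UNIV :: real set) \<and>
            (\<forall>x\<in>F. subsymmetric X N x) \<and>
            (\<forall>x\<in>F. \<forall>y\<in>F. x \<noteq> y \<longrightarrow> \<not> dominates X N x y \<and> \<not> dominates X N y x))"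
proof -
  interpret garling w p using assms by unfold_locales
  obtain L M g m where "garling_groups w p L M g m" using groups_exist by blast
  then interpret garling_groups w p L M g m .
  show ?thesis
    unfolding X_def N_def using ordered_family incomparable_family by (rule conjI)
qed

end
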